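(* Let $\Gamma$ be the mapping class group of the compact oriented surface $\Sigma$ of genus $g$ with $r$ boundary components, let $B$ be the set of BFK-diagrams on $\Sigma$, and let $S\subseteq B$ be a set of representatives of the $\Gamma$-orbits in $B$. Let $u\colon \Gamma\to \mathcal{O}(\mathcal{M})^* = \hat{\mathcal{B}} = \operatorname{Map}(B,\mathbb{C})$ be a ($1$-)cocycle, also regarded as a map $u\colon\Gamma\times B\to\mathbb{C}$ via $u(\gamma,E)=u(\gamma)(E)$. Then $u$ is a coboundary if and only if for each $D\in S$ the restriction of $u$ to $\Gamma_D\times\{D\}$ is identically $0$, where $\Gamma_D\subseteq\Gamma$ denotes the stabilizer of the diagram $D$ in $\Gamma$.
   Context: The mapping class group $\Gamma=\Gamma_{g,r}$ of $\Sigma=\Sigma_{g,r}$ is the group of orientation-preserving diffeomorphisms of $\Sigma$ fixing the boundary pointwise, modulo isotopies fixing the boundary. A geometric BFK-diagram on $\Sigma$ is a finite (possibly empty) collection of pairwise non-intersecting, non-trivial (not null-homotopic), unoriented simple loops on $\Sigma$ (parallel copies and boundary-parallel loops are allowed). A BFK-diagram is an isotopy class of geometric BFK-diagrams. $B=B(\Sigma)$ is the set of BFK-diagrams, on which $\Gamma$ acts, and $\mathcal{B}$ is the complex vector space with basis $B$. $\hat{\mathcal{B}}=\operatorname{Map}(B,\mathbb{C})$ is the vector space of all maps $B\to\mathbb{C}$, with $\Gamma$-action $(\gamma\cdot f)(E)=f(\gamma^{-1}E)$; it is the algebraic dual of $\mathcal{B}$. $\mathcal{M}$ is the moduli space of flat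 $\mathrm{SL}_2(\mathbb{C})$-connections over $\Sigma$, identified via holonomy with $\operatorname{Hom}(\pi_1(\Sigma),\mathrm{SL}_2(\mathbb{C}))/\mathrm{SL}_2(\mathbb{C})$ (quotient by conjugation). $\mathcal{O}(\mathcal{M})$ is the algebra of algebraic functions on it: choosing generators $a_1,\dots,a_n$ of a finite presentation of $\pi_1(\Sigma)$, $\operatorname{Hom}(\pi_1(\Sigma),\mathrm{SL}_2(\mathbb{C}))$ is a closed subset $H\subseteq \mathrm{SL}_2(\mathbb{C})^n$, and $\mathcal{O}(\mathcal{M})$ consists of the conjugation-invariant regular functions on $\mathrm{SL}_2(\mathbb{C})^n$ modulo those vanishing on $H$ (independent of the presentation). There is a known $\Gamma$-module isomorphism $\nu\colon\mathcal{B}\to\mathcal{O}(\mathcal{M})$, which on a single simple loop $\gamma$ is $\nu(\gamma)=-f_{\vec\gamma}$, where $\vec\gamma$ is $\gamma$ with either orientation and $f_{\vec\gamma}([A])$ is the trace of the holonomy of $A$ along $\vec\gamma$. Through it the algebraic dual $\mathcal{O}(\mathcal{M})^*$ is identified with $\hat{\mathcal{B}}$ as a $\Gamma$-module. A cocycle is a map $u\colon\Gamma\to\hat{\mathcal{B}}$ with $u(g_1g_2)=u(g_1)+g_1\cdot u(g_2)$, i.e. $u(g_1g_2,E)=u(g_1,E)+u(g_2,g_1^{-1}E)$. It is a coboundary if $u=\delta f$ for some $f\in\hat{\mathcal{B}}$, where $(\delta f)(g)=f-g\cdot f$, i.e. $(\delta f)(g,E)=f(E)-f(g^{-1}E)$.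 *)

theory Defs
  imports "HOL-Analysis.Analysis" "HOL-Algebra.Group_Action" "HOL-Algebra.Generated_Groups"
begin

section \<open>Smooth maps between subsets of Euclidean spaces\<close>

text \<open>\<open>Ck_on k f W\<close> is only used for open \<open>W\<close>.\<close>

primrec Ck_on ::
  "nat \<Rightarrow> ('e::real_normed_vector \<Rightarrow> 'f::real_normed_vector) \<Rightarrow> 'e set \<Rightarrow> bool" where
  "Ck_on 0 f W \<longleftrightarrow> continuous_on W f"
| "Ck_on (Suc k) f W \<longleftrightarrow>
     f differentiable_on W \<and> (\<forall>v. Ck_on k (\<lambda>x. frechet_derivative f (at x) v) W)"

text \<open>On an arbitrary subset (a half-plane, a circle, a closed interval, \<dots>) smoothness means
  local extendability to a smooth map on an open set.\<close>

definition smooth_on ::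
  "'e::real_normed_vector set \<Rightarrow> ('e \<Rightarrow> 'f::real_normed_vector) \<Rightarrow> bool" where
  "smooth_on S f \<longleftrightarrow>
     (\<forall>x\<in>S. \<exists>W h. open W \<and> x \<in> W \<and> (\<forall>k. Ck_on k h W) \<and> (\<forall>y\<in>W \<inter> S. h y = f y))"


section \<open>Smooth surfaces with boundary\<close>

text \<open>A smooth surface is given by an atlas whose charts \<open>(U, \<phi>)\<close> take values in the closed
  upper half-plane; the underlying point set is the union of the chart domains, with the topology
  induced from the ambient Hausdorff type.\<close>

type_synonym 'a atlas = "('a set \<times> ('a \<Rightarrow> real^2)) set"

definition half_plane :: "(real^2) set" where
  "half_plane = {y. 0 \<le> y $ 2}"

definition pts :: "'a atlas \<Rightarrow> 'a set" where
  "pts A = (\<Union>(U, \<phi>)\<in>A. U)"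

definition bdry :: "'a atlas \<Rightarrow> 'a set" where
  "bdry A = {x. \<exists>(U, \<phi>)\<in>A. x \<in> U \<and> \<phi> x $ 2 = 0}"

definition smooth_atlas :: "'a::t2_space atlas \<Rightarrow> bool" where
  "smooth_atlas A \<longleftrightarrow>
     (\<forall>(U, \<phi>)\<in>A. openin (top_of_set (pts A)) U
        \<and> openin (top_of_set half_plane) (\<phi> ` U)
        \<and> (\<exists>\<phi>'. homeomorphism U (\<phi> ` U) \<phi> \<phi>')) \<and>
     (\<forall>(U, \<phi>)\<in>A. \<forall>(V, \<psi>)\<in>A. smooth_on (\<phi> ` (U \<inter> V)) (\<psi> \<circ> inv_into U \<phi>))"

text \<open>Orientations are tested at interior points only, where the coordinate expression is defined
  on a full neighbourhood in the plane; by continuity this also determines them on the boundary.\<close>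

definition jacobian ::
  "('a set \<times> ('a \<Rightarrow> real^2)) \<Rightarrow> ('a set \<times> ('a \<Rightarrow> real^2)) \<Rightarrow> ('a \<Rightarrow> 'a) \<Rightarrow> 'a \<Rightarrow> real" where
  "jacobian = (\<lambda>(U, \<phi>) (V, \<psi>) f x.
     det (matrix (frechet_derivative (\<psi> \<circ> f \<circ> inv_into U \<phi>) (at (\<phi> x)))))"

definition orientation_preserving :: "'a::t2_space atlas \<Rightarrow> ('a \<Rightarrow> 'a) \<Rightarrow> bool" where
  "orientation_preserving A f \<longleftrightarrow>
     (\<forall>c\<in>A. \<forall>d\<in>A. \<forall>x\<in>fst c - bdry A. f x \<in> fst d - bdry A \<longrightarrow> jacobian c d f x > 0)"

definition oriented_atlas :: "'a::t2_space atlas \<Rightarrow> bool" where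
  "oriented_atlas A \<longleftrightarrow> smooth_atlas A \<and> orientation_preserving A (\<lambda>x. x)"

text \<open>Smooth maps from a subset of a Euclidean space into a surface, from a surface to itself, and
  smooth one-parameter families (parameter in \<open>[0,1]\<close>) of the latter.\<close>

definition smooth_into ::
  "'a::t2_space atlas \<Rightarrow> 'e::real_normed_vector set \<Rightarrow> ('e \<Rightarrow> 'a) \<Rightarrow> bool" where
  "smooth_into A S f \<longleftrightarrow>
     (\<forall>x\<in>S. \<exists>(V, \<psi>)\<in>A. \<exists>W. open W \<and> x \<in> W \<and> f ` (W \<inter> S) \<subseteq> V \<and> smooth_on (W \<inter> S) (\<psi> \<circ> f))"

definition smooth_self_map :: "'a::t2_space atlas \<Rightarrow> ('a \<Rightarrow> 'a) \<Rightarrow> bool" where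
  "smooth_self_map A f \<longleftrightarrow> (\<forall>(U, \<phi>)\<in>A. smooth_into A (\<phi> ` U) (f \<circ> inv_into U \<phi>))"

definition smooth_family :: "'a::t2_space atlas \<Rightarrow> (real \<Rightarrow> 'a \<Rightarrow> 'a) \<Rightarrow> bool" where
  "smooth_family A F \<longleftrightarrow>
     (\<forall>(U, \<phi>)\<in>A. smooth_into A ({0..1} \<times> \<phi> ` U) (\<lambda>(t, y). F t (inv_into U \<phi> y)))"


section \<open>Simple loops, genus, and the surfaces considered\<close>

abbreviation circle :: "complex set" where
  "circle \<equiv> sphere 0 1"

text \<open>An injective immersion of the (compact) circle is an embedding.\<close>

definition embedded_circle :: "'a::t2_space atlas \<Rightarrow> (complex \<Rightarrow> 'a) \<Rightarrow> bool" where
  "embedded_circle A c \<longleftrightarrow> smooth_into A circle c \<and> inj_on c circle \<and>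
     (\<forall>(V, \<psi>)\<in>A. \<forall>\<theta>. c (cis \<theta>) \<in> V \<longrightarrow> vector_derivative (\<lambda>s. \<psi> (c (cis s))) (at \<theta>) \<noteq> 0)"

text \<open>An unoriented simple loop is the image of an embedded circle.\<close>

definition simple_loop :: "'a::t2_space atlas \<Rightarrow> 'a set \<Rightarrow> bool" where
  "simple_loop A C \<longleftrightarrow> (\<exists>c. embedded_circle A c \<and> C = c ` circle)"

definition nontrivial_loop :: "'a::t2_space atlas \<Rightarrow> 'a set \<Rightarrow> bool" where
  "nontrivial_loop A C \<longleftrightarrow> (\<exists>c. embedded_circle A c \<and> C = c ` circle \<and>
     \<not> (\<exists>a. homotopic_with_canon (\<lambda>_. True) circle (pts A) c (\<lambda>_. a)))"

text \<open>The genus is the maximal number of pairwise disjoint simple loops in the interior whose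
  union does not disconnect the surface.\<close>

definition cut_system :: "'a::t2_space atlas \<Rightarrow> 'a set set \<Rightarrow> bool" where
  "cut_system A L \<longleftrightarrow> finite L \<and> pairwise disjnt L \<and>
     (\<forall>C\<in>L. simple_loop A C \<and> C \<subseteq> pts A - bdry A) \<and> connected (pts A - \<Union>L)"

definition has_genus :: "'a::t2_space atlas \<Rightarrow> nat \<Rightarrow> bool" where
  "has_genus A g \<longleftrightarrow> (\<exists>L. cut_system A L \<and> card L = g) \<and> (\<forall>L. cut_system A L \<longrightarrow> card L \<le> g)"

definition surface :: "nat \<Rightarrow> nat \<Rightarrow> 'a::t2_space atlas \<Rightarrow> bool" where
  "surface g r A \<longleftrightarrow> oriented_atlas A \<and> pts A \<noteq> {} \<and> compact (pts A) \<and> connected (pts A) \<and>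
     has_genus A g \<and> finite (components (bdry A)) \<and> card (components (bdry A)) = r"


section \<open>The mapping class group\<close>

definition diffeos :: "'a::t2_space atlas \<Rightarrow> ('a \<Rightarrow> 'a) set" where
  "diffeos A = {f \<in> Bij (pts A). smooth_self_map A f \<and> smooth_self_map A (inv_into (pts A) f) \<and>
     orientation_preserving A f \<and> (\<forall>x\<in>bdry A. f x = x)}"

definition diffeo_group :: "'a::t2_space atlas \<Rightarrow> ('a \<Rightarrow> 'a) monoid" where
  "diffeo_group A = (BijGroup (pts A))\<lparr>carrier := diffeos A\<rparr>"

definition isotopic_to_id :: "'a::t2_space atlas \<Rightarrow> ('a \<Rightarrow> 'a) set" where
  "isotopic_to_id A = {f. \<exists>F. smooth_family A F \<and> (\<forall>t\<in>{0..1}. F t \<in> diffeos A) \<and>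
     F 0 = \<one>\<^bsub>diffeo_group A\<^esub> \<and> F 1 = f}"

text \<open>Diffeomorphisms \<open>f\<close> and \<open>h\<close> are isotopic relative to the boundary iff
  \<open>f \<circ> h\<inverse>\<close> is isotopic to the identity, so the isotopy classes are the
  cosets of \<^term>\<open>isotopic_to_id A\<close>.\<close>

definition mcg :: "'a::t2_space atlas \<Rightarrow> ('a \<Rightarrow> 'a) set monoid" where
  "mcg A = diffeo_group A Mod isotopic_to_id A"


section \<open>BFK-diagrams\<close>

text \<open>Parallel loops are allowed: they are disjoint, hence distinct elements of the set.\<close>

definition geometric_bfk :: "'a::t2_space atlas \<Rightarrow> 'a set set \<Rightarrow> bool" where
  "geometric_bfk A D \<longleftrightarrow> finite D \<and> pairwise disjnt D \<and> (\<forall>C\<in>D. nontrivial_loop A C)"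

definition diagram_isotopy :: "'a::t2_space atlas \<Rightarrow> 'a set set \<Rightarrow> 'a set set \<Rightarrow> bool" where
  "diagram_isotopy A D D' \<longleftrightarrow> (\<exists>(n::nat) (F :: nat \<Rightarrow> real \<Rightarrow> complex \<Rightarrow> 'a).
     (\<forall>i<n. smooth_into A ({0..1} \<times> circle) (\<lambda>(t, z). F i t z)) \<and>
     (\<forall>t\<in>{0..1}. (\<forall>i<n. embedded_circle A (F i t)) \<and>
        disjoint_family_on (\<lambda>i. F i t ` circle) {..<n}) \<and>
     D = (\<lambda>i. F i 0 ` circle) ` {..<n} \<and> D' = (\<lambda>i. F i 1 ` circle) ` {..<n})"

text \<open>The concatenation of two smooth isotopies is only piecewise smooth, hence the transitive
  closure.\<close>

definition bfk_rel :: "'a::t2_space atlas \<Rightarrow> ('a set set \<times> 'a set set) set" where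
  "bfk_rel A = {(D, D'). geometric_bfk A D \<and> geometric_bfk A D' \<and> diagram_isotopy A D D'}\<^sup>+"

definition bfk :: "'a::t2_space atlas \<Rightarrow> 'a set set set set" where
  "bfk A = {D. geometric_bfk A D} // bfk_rel A"

text \<open>\<open>[f] \<cdot> [D] = [f(D)]\<close>, written as a union over all representatives (which all give the same class).\<close>

definition bfk_act ::
  "'a::t2_space atlas \<Rightarrow> ('a \<Rightarrow> 'a) set \<Rightarrow> 'a set set set \<Rightarrow> 'a set set set" where
  "bfk_act A \<gamma> = (\<lambda>E\<in>bfk A. \<Union>f\<in>\<gamma>. \<Union>D\<in>E. bfk_rel A `` {image f ` D})"

definition orbit_representatives :: "'a::t2_space atlas \<Rightarrow> 'a set set set set \<Rightarrow> bool" where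
  "orbit_representatives A S \<longleftrightarrow>
     S \<subseteq> bfk A \<and> (\<forall>Q\<in>orbits (mcg A) (bfk A) (bfk_act A). \<exists>!D. D \<in> S \<and> D \<in> Q)"

definition bfk_hat :: "'a::t2_space atlas \<Rightarrow> ('a set set set \<Rightarrow> complex) set" where
  "bfk_hat A = bfk A \<rightarrow>\<^sub>E UNIV"


section \<open>Cocycles and coboundaries\<close>

text \<open>\<open>G\<close> acts on \<open>W\<close> by \<open>a\<close>, and \<open>V\<close> is a \<open>G\<close>-stable space of complex functions on
  \<open>W\<close> with the action \<open>(g \<cdot> f)(w) = f(g\<inverse>w)\<close>.\<close>

definition cocycles ::
  "('g, 'm) monoid_scheme \<Rightarrow> 'w set \<Rightarrow> ('g \<Rightarrow> 'w \<Rightarrow> 'w) \<Rightarrow> ('w \<Rightarrow> complex) set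
     \<Rightarrow> ('g \<Rightarrow> 'w \<Rightarrow> complex) set" where
  "cocycles G W a V = {u \<in> carrier G \<rightarrow> V.
     \<forall>g\<in>carrier G. \<forall>h\<in>carrier G. \<forall>w\<in>W. u (g \<otimes>\<^bsub>G\<^esub> h) w = u g w + u h (a (inv\<^bsub>G\<^esub> g) w)}"

definition is_coboundary ::
  "('g, 'm) monoid_scheme \<Rightarrow> 'w set \<Rightarrow> ('g \<Rightarrow> 'w \<Rightarrow> 'w) \<Rightarrow> ('w \<Rightarrow> complex) set
     \<Rightarrow> ('g \<Rightarrow> 'w \<Rightarrow> complex) \<Rightarrow> bool" where
  "is_coboundary G W a V u \<longleftrightarrow>
     (\<exists>f\<in>V. \<forall>g\<in>carrier G. \<forall>w\<in>W. u g w = f w - f (a (inv\<^bsub>G\<^esub> g) w))"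


section \<open>The moduli space and its algebraic functions\<close>

definition loops_at :: "'a::t2_space set \<Rightarrow> 'a \<Rightarrow> (real \<Rightarrow> 'a) set" where
  "loops_at X p = {l. path l \<and> path_image l \<subseteq> X \<and> pathstart l = p \<and> pathfinish l = p}"

definition loop_class :: "'a::t2_space set \<Rightarrow> (real \<Rightarrow> 'a) \<Rightarrow> (real \<Rightarrow> 'a) set" where
  "loop_class X l = {l'. homotopic_paths X l l'}"

definition pi1 :: "'a::t2_space set \<Rightarrow> 'a \<Rightarrow> (real \<Rightarrow> 'a) set monoid" where
  "pi1 X p = \<lparr>carrier = loop_class X ` loops_at X p,
     mult = (\<lambda>x y. \<Union>l\<in>x. \<Union>m\<in>y. loop_class X (l +++ m)),
     one = loop_class X (\<lambda>_. p)\<rparr>"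

definition SL2 :: "(complex^2^2) monoid" where
  "SL2 = \<lparr>carrier = {P. det P = 1}, mult = (**), one = mat 1\<rparr>"

type_synonym 'a rep = "(real \<Rightarrow> 'a) set \<Rightarrow> complex^2^2"

definition reps :: "'a::t2_space atlas \<Rightarrow> 'a \<Rightarrow> 'a rep set" where
  "reps A p = hom (pi1 (pts A) p) SL2 \<inter> extensional (carrier (pi1 (pts A) p))"

definition conj_rel :: "'a::t2_space atlas \<Rightarrow> 'a \<Rightarrow> ('a rep \<times> 'a rep) set" where
  "conj_rel A p = {(\<rho>, \<rho>'). \<rho> \<in> reps A p \<and> \<rho>' \<in> reps A p \<and>
     (\<exists>P\<in>carrier SL2. \<forall>x\<in>carrier (pi1 (pts A) p). \<rho>' x = P ** \<rho> x ** matrix_inv P)}"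

definition moduli :: "'a::t2_space atlas \<Rightarrow> 'a \<Rightarrow> 'a rep set set" where
  "moduli A p = reps A p // conj_rel A p"

text \<open>Polynomial functions in the matrix entries of the first \<open>n\<close> members of a family of
  matrices; their restrictions to families in \<^const>\<open>SL2\<close> are the regular functions on
  \<open>SL2 ^ n\<close>.\<close>

inductive_set polyfuns :: "nat \<Rightarrow> ((nat \<Rightarrow> complex^2^2) \<Rightarrow> complex) set" for n :: nat where
  const: "(\<lambda>_. c) \<in> polyfuns n"
| entry: "i < n \<Longrightarrow> (\<lambda>M. M i $ j $ k) \<in> polyfuns n"
| add: "f \<in> polyfuns n \<Longrightarrow> h \<in> polyfuns n \<Longrightarrow> (\<lambda>M. f M + h M) \<in> polyfuns n"
| mult: "f \<in> polyfuns n \<Longrightarrow> h \<in> polyfuns n \<Longrightarrow> (\<lambda>M. f M * h M) \<in> polyfuns n"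

definition conj_invariant :: "nat \<Rightarrow> ((nat \<Rightarrow> complex^2^2) \<Rightarrow> complex) \<Rightarrow> bool" where
  "conj_invariant n f \<longleftrightarrow> (\<forall>M P. (\<forall>i<n. M i \<in> carrier SL2) \<and> P \<in> carrier SL2 \<longrightarrow>
     f (\<lambda>i. P ** M i ** matrix_inv P) = f M)"

text \<open>\<open>as\<close> lists generators of the fundamental group. Functions on \<open>SL2 ^ n\<close> modulo those
  vanishing on the representation variety are realised as functions on \<^term>\<open>moduli A p\<close>.\<close>

definition generators :: "'a::t2_space atlas \<Rightarrow> 'a \<Rightarrow> (real \<Rightarrow> 'a) set list \<Rightarrow> bool" where
  "generators A p as \<longleftrightarrow> set as \<subseteq> carrier (pi1 (pts A) p) \<and>
     generate (pi1 (pts A) p) (set as) = carrier (pi1 (pts A) p)"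

definition alg_funs ::
  "'a::t2_space atlas \<Rightarrow> 'a \<Rightarrow> (real \<Rightarrow> 'a) set list \<Rightarrow> ('a rep set \<Rightarrow> complex) set" where
  "alg_funs A p as = {f \<in> extensional (moduli A p).
     \<exists>h\<in>polyfuns (length as). conj_invariant (length as) h \<and>
       (\<forall>\<rho>\<in>reps A p. f (conj_rel A p `` {\<rho>}) = h (\<lambda>i. \<rho> (as ! i)))}"

text \<open>Pull-back of flat connections along a mapping class, \<open>\<gamma>\<^sup>*[\<rho>] = [\<rho> \<circ> \<gamma>\<^sub>*]\<close>.  A
  representative \<open>f\<close> of \<open>\<gamma>\<close> need not fix the base point, so \<open>f \<circ> l\<close> is transported back along a
  path \<open>h\<close> from \<open>p\<close> to \<open>f p\<close>; the choice of \<open>h\<close> does not affect the conjugacy class.\<close>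

definition pullback ::
  "'a::t2_space atlas \<Rightarrow> 'a \<Rightarrow> ('a \<Rightarrow> 'a) set \<Rightarrow> 'a rep set \<Rightarrow> 'a rep set" where
  "pullback A p \<gamma> m = {\<rho>' \<in> reps A p. \<exists>f\<in>\<gamma>. \<exists>\<rho>\<in>m. \<exists>h.
     path h \<and> path_image h \<subseteq> pts A \<and> pathstart h = p \<and> pathfinish h = f p \<and>
     (\<forall>l\<in>loops_at (pts A) p. \<rho>' (loop_class (pts A) l) =
        \<rho> (loop_class (pts A) (h +++ (f \<circ> l) +++ reversepath h)))}"

text \<open>\<open>(\<gamma> \<cdot> f)(m) = f(\<gamma>\<inverse> \<cdot> m)\<close>, where \<open>\<gamma>\<inverse>\<close> acts on the moduli space as \<open>\<gamma>\<^sup>*\<close>.\<close>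

definition alg_act ::
  "'a::t2_space atlas \<Rightarrow> 'a \<Rightarrow> ('a \<Rightarrow> 'a) set \<Rightarrow> ('a rep set \<Rightarrow> complex) \<Rightarrow> 'a rep set \<Rightarrow> complex" where
  "alg_act A p \<gamma> f = (\<lambda>m\<in>moduli A p. f (pullback A p \<gamma> m))"

definition alg_dual ::
  "'a::t2_space atlas \<Rightarrow> 'a \<Rightarrow> (real \<Rightarrow> 'a) set list \<Rightarrow> (('a rep set \<Rightarrow> complex) \<Rightarrow> complex) set" where
  "alg_dual A p as = {\<xi> \<in> extensional (alg_funs A p as).
     (\<forall>f\<in>alg_funs A p as. \<forall>h\<in>alg_funs A p as. \<xi> (\<lambda>m\<in>moduli A p. f m + h m) = \<xi> f + \<xi> h) \<and>
     (\<forall>c. \<forall>f\<in>alg_funs A p as. \<xi> (\<lambda>m\<in>moduli A p. c * f m) = c * \<xi> f)}"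


section \<open>The isomorphism between the span of the BFK-diagrams and the algebraic functions\<close>

definition bfk_span :: "'a::t2_space atlas \<Rightarrow> ('a set set set \<Rightarrow> complex) set" where
  "bfk_span A = {x. finite {E. x E \<noteq> 0} \<and> {E. x E \<noteq> 0} \<subseteq> bfk A}"

definition basis_vec :: "'d \<Rightarrow> 'd \<Rightarrow> complex" where
  "basis_vec D = (\<lambda>E. if E = D then 1 else 0)"

text \<open>The action on \<^term>\<open>bfk_span A\<close> extending \<open>\<gamma> \<cdot> basis_vec E = basis_vec (\<gamma>E)\<close>.\<close>

definition span_act ::
  "'a::t2_space atlas \<Rightarrow> ('a \<Rightarrow> 'a) set \<Rightarrow> ('a set set set \<Rightarrow> complex) \<Rightarrow> 'a set set set \<Rightarrow> complex" where
  "span_act A \<gamma> x = (\<lambda>E. if E \<in> bfk A then x (bfk_act A (inv\<^bsub>mcg A\<^esub> \<gamma>) E) else 0)"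

text \<open>Isomorphisms of modules over the mapping class group that send a simple loop to minus the
  trace of the holonomy along it.  The loop \<open>c\<close> is joined to the base point by an arbitrary path
  \<open>h\<close>.\<close>

definition holonomy_iso ::
  "'a::t2_space atlas \<Rightarrow> 'a \<Rightarrow> (real \<Rightarrow> 'a) set list
     \<Rightarrow> (('a set set set \<Rightarrow> complex) \<Rightarrow> 'a rep set \<Rightarrow> complex) \<Rightarrow> bool" where
  "holonomy_iso A p as \<nu> \<longleftrightarrow>
     bij_betw \<nu> (bfk_span A) (alg_funs A p as) \<and>
     (\<forall>x\<in>bfk_span A. \<forall>y\<in>bfk_span A. \<nu> (\<lambda>E. x E + y E) = (\<lambda>m\<in>moduli A p. \<nu> x m + \<nu> y m)) \<and>
     (\<forall>c. \<forall>x\<in>bfk_span A. \<nu> (\<lambda>E. c * x E) = (\<lambda>m\<in>moduli A p. c * \<nu> x m)) \<and>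
     (\<forall>\<gamma>\<in>carrier (mcg A). \<forall>x\<in>bfk_span A. \<nu> (span_act A \<gamma> x) = alg_act A p \<gamma> (\<nu> x)) \<and>
     (\<forall>c h. embedded_circle A c \<and> nontrivial_loop A (c ` circle) \<and>
        path h \<and> path_image h \<subseteq> pts A \<and> pathstart h = p \<and> pathfinish h = c 1 \<longrightarrow>
        (\<forall>\<rho>\<in>reps A p.
           \<nu> (basis_vec (bfk_rel A `` {{c ` circle}})) (conj_rel A p `` {\<rho>}) =
           - trace (\<rho> (loop_class (pts A)
               (h +++ (\<lambda>t. c (cis (2 * pi * t))) +++ reversepath h)))))"

end

theory Submission
  imports Defs
begin

text \<open>If \<open>u = \<delta>f\<close> then \<open>u(\<gamma>, D) = f(D) - f(\<gamma>\<inverse>D) = 0\<close> whenever \<open>\<gamma>\<close> fixes \<open>D\<close>. For the converse, suppose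
  that \<open>u\<close> vanishes on \<open>\<Gamma>\<^sub>D \<times> {D}\<close> for the chosen representatives \<open>D\<close>. A function \<open>f\<close> with \<open>\<delta>f = u\<close> that is
  \<open>0\<close> at the representatives must satisfy \<open>f(gD) = u(g, gD)\<close>. This is a consistent definition:
  another element moving \<open>D\<close> to the same point has the form \<open>gs\<close> with \<open>s\<close> in the stabilizer, and
  \<open>u(gs, gD) = u(g, gD) + u(s, D) = u(g, gD)\<close>. The cocycle identity then gives \<open>\<delta>f = u\<close>. The
  argument works for every action of a group on a set (\<open>cocycle_coboundary_iff\<close>), since all functions
  on the set are admitted as \<open>f\<close>.

  To apply it one needs the mapping class group to be a group that acts on the set of BFK-diagrams
  (\<open>group_mcg\<close>, \<open>group_action_bfk\<close>), and this takes up most of the text, starting from smooth maps between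
  charts. Diffeomorphisms are closed under composition by the chain rule, which also makes the
  Jacobian determinants multiplicative. Those isotopic to the identity form a normal subgroup because
  isotopies can be composed pointwise, conjugated, and inverted: if \<open>F\<close> is an isotopy from the identity
  to \<open>f\<close>, then \<open>t \<mapsto> F\<^bsub>1-t\<^esub> \<circ> f\<inverse>\<close> is one from the identity to \<open>f\<inverse>\<close>, so that no smooth dependence of
  inverses on parameters has to be shown. A diffeomorphism carries essential simple loops to essential
  simple loops and isotopies of diagrams to isotopies of diagrams, and an isotopy from the identity to
  \<open>\<eta>\<close> moves each diagram \<open>D\<close> along an isotopy of diagrams to \<open>\<eta>(D)\<close>; hence the class of \<open>f(D)\<close> depends
  only on the classes of \<open>f\<close> and \<open>D\<close>.

  The dual of the algebraic functions is reduced to functions on diagrams through the basis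
  \<open>\<nu>(D)\<close>. Since \<open>\<nu>\<close> is equivariant, a cocycle with values in the dual restricts on this basis to a cocycle on
  diagrams, and a function \<open>f\<close> on diagrams extends to a unique linear functional with values \<open>f(D)\<close> at
  \<open>\<nu>(D)\<close>. Linear functionals that agree on the basis are equal, so coboundaries correspond to
  coboundaries (\<open>alg_coboundary_iff\<close>).\<close>

section \<open>Calculus of smooth maps\<close>

lemma frechet_derivative_cong_open:
  assumes "open W" "x \<in> W" "\<And>y. y \<in> W \<Longrightarrow> f y = g y"
  shows "frechet_derivative f (at x) = frechet_derivative g (at x)"
proof -
  have "(f has_derivative D) (at x) \<longleftrightarrow> (g has_derivative D) (at x)" for D
    using has_derivative_transform_within_open[of f D x UNIV W g]
      has_derivative_transform_within_open[of g D x UNIV W f] assms by metis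
  then show ?thesis
    by (simp add: frechet_derivative_def)
qed

lemma Ck_on_cong:
  assumes "open W" "\<And>x. x \<in> W \<Longrightarrow> f x = g x" "Ck_on k f W"
  shows "Ck_on k g W"
  using assms(2,3)
proof (induction k arbitrary: f g)
  case 0
  then show ?case
    using continuous_on_eq by auto
next
  case (Suc k)
  have "g differentiable_on W"
    using Suc.prems by (auto simp: differentiable_on_def intro: differentiable_transform_within[where d=1])
  moreover have "Ck_on k (\<lambda>x. frechet_derivative g (at x) v) W" for v
    by (rule Suc.IH[of "\<lambda>x. frechet_derivative f (at x) v"])
      (use Suc.prems frechet_derivative_cong_open[OF \<open>open W\<close>, of _ f g] in auto)
  ultimately show ?case
    by simp
qed

lemma Ck_on_subset:
  assumes "open W" "open V" "V \<subseteq> W" "Ck_on k f W"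
  shows "Ck_on k f V"
  using assms(4)
  by (induction k arbitrary: f)
    (use assms in \<open>auto intro: continuous_on_subset differentiable_on_subset\<close>)

text \<open>The definition differentiates with \<^const>\<open>frechet_derivative\<close>, which is a choice; on an open set any formula
  for the derivative may be used instead.\<close>

lemma Ck_on_SucI:
  assumes "open W" "\<And>x. x \<in> W \<Longrightarrow> (f has_derivative f' x) (at x)"
    and "\<And>v. Ck_on k (\<lambda>x. f' x v) W"
  shows "Ck_on (Suc k) f W"
proof -
  have "f differentiable_on W"
    using assms(2) by (metis differentiable_at_imp_differentiable_on differentiable_def)
  moreover have "Ck_on k (\<lambda>x. frechet_derivative f (at x) v) W" for v
    by (rule Ck_on_cong[OF assms(1) _ assms(3)]) (simp flip: frechet_derivative_at[OF assms(2)])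
  ultimately show ?thesis
    by simp
qed

lemma Ck_on_Suc_has_derivative:
  assumes "open W" "Ck_on (Suc k) f W" "x \<in> W"
  shows "(f has_derivative frechet_derivative f (at x)) (at x)"
proof -
  have "f differentiable (at x within W)"
    using assms(2,3) by (simp add: differentiable_on_def)
  then show ?thesis
    by (simp add: at_within_open[OF assms(3,1)] frechet_derivative_works)
qed

lemma Ck_on_SucD: "Ck_on (Suc k) f W \<Longrightarrow> Ck_on k f W"
  by (induction k arbitrary: f) (auto simp: differentiable_imp_continuous_on)

lemma Ck_on_const: "open W \<Longrightarrow> Ck_on k (\<lambda>_. c) W"
proof (induction k arbitrary: c)
  case (Suc k)
  then show ?case
    by (intro Ck_on_SucI[where f' = "\<lambda>_ _. 0"]) auto
qed auto

lemma Ck_on_bounded_linear: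
  assumes "open W" "bounded_linear f"
  shows "Ck_on k f W"
proof (cases k)
  case 0
  then show ?thesis
    using assms by (simp add: linear_continuous_on)
next
  case (Suc j)
  then show ?thesis
    unfolding Suc using assms
    by (intro Ck_on_SucI[where f' = "\<lambda>_. f"] Ck_on_const bounded_linear_imp_has_derivative)
qed

lemma Ck_on_bounded_linear_compose:
  assumes "open W" "bounded_linear L" "Ck_on k f W"
  shows "Ck_on k (\<lambda>x. L (f x)) W"
  using assms(3)
proof (induction k arbitrary: f)
  case 0
  then show ?case
    using bounded_linear.continuous_on[OF assms(2)] by simp
next
  case (Suc k)
  show ?case
  proof (rule Ck_on_SucI[OF \<open>open W\<close>])
    show "((\<lambda>x. L (f x)) has_derivative (\<lambda>v. L (frechet_derivative f (at x) v))) (at x)" if "x \<in> W" for x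
      by (intro bounded_linear.has_derivative[OF assms(2)] Ck_on_Suc_has_derivative[OF \<open>open W\<close> Suc.prems(1) that])
    show "Ck_on k (\<lambda>x. L (frechet_derivative f (at x) v)) W" for v
      using Suc by auto
  qed
qed

lemma Ck_on_add:
  assumes "open W" "Ck_on k f W" "Ck_on k g W"
  shows "Ck_on k (\<lambda>x. f x + g x) W"
  using assms(2,3)
proof (induction k arbitrary: f g)
  case 0
  then show ?case
    by (simp add: continuous_on_add)
next
  case (Suc k)
  show ?case
  proof (rule Ck_on_SucI[OF \<open>open W\<close>])
    show "((\<lambda>x. f x + g x) has_derivative (\<lambda>v. frechet_derivative f (at x) v + frechet_derivative g (at x) v)) (at x)" if "x \<in> W" for x
      by (intro has_derivative_add Ck_on_Suc_has_derivative[OF \<open>open W\<close> Suc.prems(1) that] Ck_on_Suc_has_derivative[OF \<open>open W\<close> Suc.prems(2) that])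
    show "Ck_on k (\<lambda>x. frechet_derivative f (at x) v + frechet_derivative g (at x) v) W" for v
      using Suc by auto
  qed
qed

lemma Ck_on_sum:
  assumes "open W" "finite I" "\<And>i. i \<in> I \<Longrightarrow> Ck_on k (f i) W"
  shows "Ck_on k (\<lambda>x. \<Sum>i\<in>I. f i x) W"
  using assms(2,3)
  by (induction I) (auto simp: Ck_on_const[OF assms(1)] intro: Ck_on_add[OF assms(1)])

lemma Ck_on_scaleR:
  assumes "open W" "Ck_on k f W" "Ck_on k g W"
  shows "Ck_on k (\<lambda>x. f x *\<^sub>R g x) W"
  using assms(2,3)
proof (induction k arbitrary: f g)
  case 0
  then show ?case
    by (simp add: continuous_on_scaleR)
next
  case (Suc k)
  show ?case
  proof (rule Ck_on_SucI[OF \<open>open W\<close>])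
    show "((\<lambda>x. f x *\<^sub>R g x) has_derivative
        (\<lambda>v. f x *\<^sub>R frechet_derivative g (at x) v + frechet_derivative f (at x) v *\<^sub>R g x)) (at x)"
      if "x \<in> W" for x
      by (intro has_derivative_scaleR Ck_on_Suc_has_derivative[OF \<open>open W\<close> Suc.prems(1) that] Ck_on_Suc_has_derivative[OF \<open>open W\<close> Suc.prems(2) that])
    show "Ck_on k (\<lambda>x. f x *\<^sub>R frechet_derivative g (at x) v + frechet_derivative f (at x) v *\<^sub>R g x) W"
      for v
      using Suc Ck_on_SucD[of k f] Ck_on_SucD[of k g] by (intro Ck_on_add[OF \<open>open W\<close>] Suc.IH) auto
  qed
qed

lemma Ck_on_Pair:
  assumes "open W" "Ck_on k f W" "Ck_on k g W"
  shows "Ck_on k (\<lambda>x. (f x, g x)) W"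
  using assms(2,3)
proof (induction k arbitrary: f g)
  case 0
  then show ?case
    by (simp add: continuous_on_Pair)
next
  case (Suc k)
  show ?case
  proof (rule Ck_on_SucI[OF \<open>open W\<close>])
    show "((\<lambda>x. (f x, g x)) has_derivative (\<lambda>v. (frechet_derivative f (at x) v, frechet_derivative g (at x) v))) (at x)" if "x \<in> W" for x
      by (intro has_derivative_Pair Ck_on_Suc_has_derivative[OF \<open>open W\<close> Suc.prems(1) that] Ck_on_Suc_has_derivative[OF \<open>open W\<close> Suc.prems(2) that])
    show "Ck_on k (\<lambda>x. (frechet_derivative f (at x) v, frechet_derivative g (at x) v)) W" for v
      using Suc by auto
  qed
qed

text \<open>By the chain rule \<open>(g \<circ> f)' v = g' (f' v)\<close>, and expanding \<open>f' v\<close> in an orthonormal basis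
  turns this into a sum of products of a partial derivative of \<open>f\<close> with the composition of a
  partial derivative of \<open>g\<close> and \<open>f\<close>, to which induction applies. This is why the middle space is
  Euclidean.\<close>

lemma Ck_on_compose:
  fixes f :: "'e::real_normed_vector \<Rightarrow> 'f::euclidean_space"
    and g :: "'f \<Rightarrow> 'g::real_normed_vector"
  assumes "open W" "open T" "f ` W \<subseteq> T" "Ck_on k f W" "Ck_on k g T"
  shows "Ck_on k (g \<circ> f) W"
  using assms(4,5)
proof (induction k arbitrary: g)
  case 0
  then show ?case
    using assms(3) continuous_on_compose continuous_on_subset unfolding Ck_on.simps by blast
next
  case (Suc k)
  let ?f' = "\<lambda>x. frechet_derivative f (at x)" and ?g' = "\<lambda>y. frechet_derivative g (at y)"
  have df: "(f has_derivative ?f' x) (at x)" if "x \<in> W" for x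
    using Ck_on_Suc_has_derivative[OF assms(1) Suc.prems(1) that] .
  have dg: "(g has_derivative ?g' (f x)) (at (f x))" if "x \<in> W" for x
    using Ck_on_Suc_has_derivative[OF assms(2) Suc.prems(2)] that assms(3) by blast
  show ?case
  proof (rule Ck_on_SucI[OF assms(1)])
    show "(g \<circ> f has_derivative ?g' (f x) \<circ> ?f' x) (at x)" if "x \<in> W" for x
      by (rule diff_chain_at[OF df dg]) (use that in auto)
    fix v
    have expand: "(?g' (f x) \<circ> ?f' x) v =
        (\<Sum>b\<in>Basis. (?f' x v \<bullet> b) *\<^sub>R ((\<lambda>y. ?g' y b) \<circ> f) x)" if "x \<in> W" for x
    proof -
      have lin: "linear (?g' (f x))"
        using dg[OF that] has_derivative_linear by blast
      have "(?g' (f x) \<circ> ?f' x) v = ?g' (f x) (\<Sum>b\<in>Basis. (?f' x v \<bullet> b) *\<^sub>R b)"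
        by (simp add: euclidean_representation)
      also have "\<dots> = (\<Sum>b\<in>Basis. (?f' x v \<bullet> b) *\<^sub>R ((\<lambda>y. ?g' y b) \<circ> f) x)"
        by (simp add: linear_sum[OF lin] linear_scale[OF lin])
      finally show ?thesis .
    qed
    have coord: "Ck_on k (\<lambda>x. ?f' x v \<bullet> b) W" for b
      using Suc.prems(1) Ck_on_bounded_linear_compose[OF assms(1) bounded_linear_inner_left] by auto
    have "Ck_on k (\<lambda>x. \<Sum>b\<in>Basis. (?f' x v \<bullet> b) *\<^sub>R ((\<lambda>y. ?g' y b) \<circ> f) x) W"
    proof (intro Ck_on_sum Ck_on_scaleR assms(1) coord finite_Basis Suc.IH)
      show "Ck_on k f W"
        using Suc.prems(1) by (rule Ck_on_SucD)
      show "Ck_on k (\<lambda>y. ?g' y b) T" for b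
        using Suc.prems(2) by simp
    qed
    then show "Ck_on k (\<lambda>x. (?g' (f x) \<circ> ?f' x) v) W"
      by (rule Ck_on_cong[OF assms(1), rotated]) (simp only: expand)
  qed
qed

lemma smooth_onE:
  assumes "smooth_on S f" "x \<in> S"
  obtains W h where "open W" "x \<in> W" "\<forall>k. Ck_on k h W" "\<forall>y\<in>W \<inter> S. h y = f y"
  using assms unfolding smooth_on_def by blast

lemma smooth_on_cong:
  assumes "smooth_on S f" "\<And>x. x \<in> S \<Longrightarrow> f x = g x"
  shows "smooth_on S g"
  using assms unfolding smooth_on_def by (metis IntD2)

lemma smooth_on_subset:
  assumes "smooth_on S f" "T \<subseteq> S"
  shows "smooth_on T f"
  unfolding smooth_on_def
proof
  fix x assume "x \<in> T"
  then obtain W h where "open W" "x \<in> W" "\<forall>k. Ck_on k h W" "\<forall>y\<in>W \<inter> S. h y = f y"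
    using smooth_onE[OF assms(1), of x] assms(2) by blast
  with assms(2) show "\<exists>W h. open W \<and> x \<in> W \<and> (\<forall>k. Ck_on k h W) \<and> (\<forall>y\<in>W \<inter> T. h y = f y)"
    by (intro exI[of _ W] exI[of _ h]) auto
qed

lemma smooth_on_const: "smooth_on S (\<lambda>_. c)"
  unfolding smooth_on_def using Ck_on_const[OF open_UNIV, of _ c]
  by (intro ballI exI[of _ UNIV] exI[of _ "\<lambda>_. c"]) auto

lemma smooth_on_bounded_linear: "bounded_linear f \<Longrightarrow> smooth_on S f"
  unfolding smooth_on_def using Ck_on_bounded_linear[OF open_UNIV, of f]
  by (intro ballI exI[of _ UNIV] exI[of _ f]) auto

lemma smooth_on_Pair:
  assumes "smooth_on S f" "smooth_on S g"
  shows "smooth_on S (\<lambda>x. (f x, g x))"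
  unfolding smooth_on_def
proof
  fix x assume "x \<in> S"
  obtain V f' where V: "open V" "x \<in> V" "\<forall>k. Ck_on k f' V" "\<forall>y\<in>V \<inter> S. f' y = f y"
    using smooth_onE[OF assms(1) \<open>x \<in> S\<close>] by blast
  obtain W g' where W: "open W" "x \<in> W" "\<forall>k. Ck_on k g' W" "\<forall>y\<in>W \<inter> S. g' y = g y"
    using smooth_onE[OF assms(2) \<open>x \<in> S\<close>] by blast
  have "Ck_on k (\<lambda>x. (f' x, g' x)) (V \<inter> W)" for k
    using V W by (intro Ck_on_Pair) (auto intro: Ck_on_subset)
  with V W show "\<exists>W h. open W \<and> x \<in> W \<and> (\<forall>k. Ck_on k h W) \<and> (\<forall>y\<in>W \<inter> S. h y = (f y, g y))"
    by (intro exI[of _ "V \<inter> W"] exI[of _ "\<lambda>x. (f' x, g' x)"]) auto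
qed

lemma smooth_on_compose:
  fixes f :: "'e::real_normed_vector \<Rightarrow> 'f::euclidean_space"
    and g :: "'f \<Rightarrow> 'g::real_normed_vector"
  assumes "smooth_on S f" "smooth_on T g" "f ` S \<subseteq> T"
  shows "smooth_on S (g \<circ> f)"
  unfolding smooth_on_def
proof
  fix x assume "x \<in> S"
  obtain V f' where V: "open V" "x \<in> V" "\<forall>k. Ck_on k f' V" "\<forall>y\<in>V \<inter> S. f' y = f y"
    using smooth_onE[OF assms(1) \<open>x \<in> S\<close>] by blast
  have "f x \<in> T"
    using \<open>x \<in> S\<close> assms(3) by blast
  obtain W g' where W: "open W" "f x \<in> W" "\<forall>k. Ck_on k g' W" "\<forall>y\<in>W \<inter> T. g' y = g y"
    using smooth_onE[OF assms(2) \<open>f x \<in> T\<close>] by blast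
  let ?U = "V \<inter> f' -` W"
  have U: "open ?U"
    using spec[OF V(3), of 0] V(1) W(1) by (simp add: continuous_on_open_vimage Int_commute)
  have "Ck_on k (g' \<circ> f') ?U" for k
    using U V W by (intro Ck_on_compose[of ?U W]) (auto intro: Ck_on_subset[of V])
  moreover have "(g' \<circ> f') y = (g \<circ> f) y" if "y \<in> ?U \<inter> S" for y
    using that V(4) W(4) assms(3) by auto
  ultimately show "\<exists>W h. open W \<and> x \<in> W \<and> (\<forall>k. Ck_on k h W) \<and> (\<forall>y\<in>W \<inter> S. h y = (g \<circ> f) y)"
    using U V W \<open>x \<in> S\<close> by (intro exI[of _ ?U] exI[of _ "g' \<circ> f'"]) auto
qed

lemma smooth_on_imp_continuous_on:
  assumes "smooth_on S f"
  shows "continuous_on S f"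
  unfolding continuous_on_eq_continuous_within
proof
  fix x assume "x \<in> S"
  obtain V h where V: "open V" "x \<in> V" "\<forall>k. Ck_on k h V" "\<forall>y\<in>V \<inter> S. h y = f y"
    using smooth_onE[OF assms \<open>x \<in> S\<close>] by blast
  have "continuous_on (V \<inter> S) f"
    using spec[OF V(3), of 0] V(4) by (auto intro: continuous_on_subset continuous_on_eq[of _ h])
  moreover have "at x within (V \<inter> S) = at x within S"
    by (rule at_within_nhd[OF V(2,1)]) auto
  ultimately show "continuous (at x within S) f"
    using \<open>x \<in> S\<close> V(2) by (metis IntI continuous_on_eq_continuous_within)
qed

text \<open>At a boundary point of \<open>S\<close> the map itself need not have a unique derivative; arguments about
  derivatives there go through an extension to a neighbourhood.\<close>

lemma smooth_on_extension_differentiable: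
  assumes "smooth_on S f" "x \<in> S"
  obtains W h where "open W" "x \<in> W" "h differentiable (at x)"
    "\<forall>y\<in>W \<inter> S. h y = f y"
proof -
  obtain W h where W: "open W" "x \<in> W" "\<forall>k. Ck_on k h W" "\<forall>y\<in>W \<inter> S. h y = f y"
    using smooth_onE[OF assms] by blast
  have "h differentiable (at x)"
    using Ck_on_Suc_has_derivative[OF W(1) spec[OF W(3), of "Suc 0"] W(2)] by (auto simp: differentiable_def)
  with W show ?thesis
    using that by blast
qed

lemma smooth_on_differentiable_interior:
  assumes "smooth_on S f" "x \<in> interior S"
  shows "f differentiable (at x)"
proof -
  obtain W h where "open W" "x \<in> W" and h: "h differentiable (at x)"
    "\<forall>y\<in>W \<inter> S. h y = f y"
    using smooth_on_extension_differentiable[OF assms(1)] assms(2) interior_subset by blast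
  moreover obtain D where "(h has_derivative D) (at x)"
    using h(1) by (auto simp: differentiable_def)
  ultimately have "(f has_derivative D) (at x)"
    using assms(2) interior_subset[of S]
    by (intro has_derivative_transform_within_open[of h D x UNIV "W \<inter> interior S" f]) auto
  then show ?thesis
    by (auto simp: differentiable_def)
qed

text \<open>For running an isotopy backwards.\<close>

lemma smooth_on_reflect: "smooth_on S (\<lambda>(t::real, y::'e::real_normed_vector). 1 - t)"
proof -
  have "Ck_on k (\<lambda>p::real \<times> 'e. 1 + - fst p) UNIV" for k
    by (intro Ck_on_add Ck_on_const Ck_on_bounded_linear bounded_linear_minus bounded_linear_fst open_UNIV)
  then have "smooth_on S (\<lambda>p::real \<times> 'e. 1 + - fst p)"
    unfolding smooth_on_def by (intro ballI exI[of _ UNIV] exI[of _ "\<lambda>p. 1 + - fst p"]) auto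
  then show ?thesis
    by (rule smooth_on_cong) auto
qed

text \<open>Up to a complex factor, the derivative of \<^const>\<open>cis\<close> is \<^const>\<open>cis\<close> again. Allowing an arbitrary factor
  therefore makes the induction on the order close up.\<close>

lemma smooth_on_cis: "smooth_on S cis"
proof -
  have "Ck_on k (\<lambda>s. a * cis s) UNIV" for k a
  proof (induction k arbitrary: a)
    case 0
    then show ?case
      by (auto intro!: continuous_intros)
  next
    case (Suc k)
    show ?case
    proof (rule Ck_on_SucI[OF open_UNIV])
      show "((\<lambda>s. a * cis s) has_derivative (\<lambda>v. (of_real v * \<i> * a) * cis s)) (at s)" for s
      proof -
        have "(cis has_derivative (\<lambda>v. v *\<^sub>R (\<i> * cis s))) (at s)"
          by (rule has_derivative_cis[OF has_derivative_ident])
        from has_derivative_mult_right[OF this, of a] show ?thesis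
          by (simp add: scaleR_conv_of_real algebra_simps)
      qed
      show "Ck_on k (\<lambda>s. (of_real v * \<i> * a) * cis s) UNIV" for v
        by (rule Suc.IH)
    qed
  qed
  from this[of _ 1] show ?thesis
    unfolding smooth_on_def by (intro ballI exI[of _ UNIV] exI[of _ cis]) auto
qed

section \<open>Charts and smooth maps into a surface\<close>

locale oriented_surface =
  fixes A :: "'a::t2_space atlas"
  assumes oriented: "oriented_atlas A"
begin

abbreviation X :: "'a set" where
  "X \<equiv> pts A"

lemma smooth_atlas: "smooth_atlas A"
  using oriented by (simp add: oriented_atlas_def)

lemma chart_openin: "(U, \<phi>) \<in> A \<Longrightarrow> openin (top_of_set X) U"
  using smooth_atlas unfolding smooth_atlas_def by blast

lemma chart_subset: "(U, \<phi>) \<in> A \<Longrightarrow> U \<subseteq> X"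
  unfolding pts_def by blast

lemma chart_image_openin: "(U, \<phi>) \<in> A \<Longrightarrow> openin (top_of_set half_plane) (\<phi> ` U)"
  using smooth_atlas unfolding smooth_atlas_def by blast

lemma chart_homeomorphism:
  assumes "(U, \<phi>) \<in> A"
  obtains \<phi>' where "homeomorphism U (\<phi> ` U) \<phi> \<phi>'"
  using smooth_atlas assms unfolding smooth_atlas_def by blast

lemma transition_smooth:
  "(U, \<phi>) \<in> A \<Longrightarrow> (V, \<psi>) \<in> A \<Longrightarrow> smooth_on (\<phi> ` (U \<inter> V)) (\<psi> \<circ> inv_into U \<phi>)"
  using smooth_atlas unfolding smooth_atlas_def by blast

lemma chart_inj: "(U, \<phi>) \<in> A \<Longrightarrow> inj_on \<phi> U"
  by (erule chart_homeomorphism) (auto simp: homeomorphism_def intro: inj_on_inverseI)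

lemma chart_inv [simp]: "(U, \<phi>) \<in> A \<Longrightarrow> x \<in> U \<Longrightarrow> inv_into U \<phi> (\<phi> x) = x"
  by (simp add: chart_inj)

lemma chart_continuous: "(U, \<phi>) \<in> A \<Longrightarrow> continuous_on U \<phi>"
  by (erule chart_homeomorphism) (auto simp: homeomorphism_def)

lemma chart_inv_continuous:
  assumes "(U, \<phi>) \<in> A"
  shows "continuous_on (\<phi> ` U) (inv_into U \<phi>)"
proof -
  obtain \<phi>' where h: "homeomorphism U (\<phi> ` U) \<phi> \<phi>'"
    using chart_homeomorphism[OF assms] .
  then have "continuous_on (\<phi> ` U) \<phi>'"
    by (simp add: homeomorphism_def)
  then show ?thesis
    by (rule continuous_on_eq) (use h assms in \<open>auto simp: homeomorphism_def\<close>)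
qed

lemma chart_at:
  assumes "x \<in> X"
  obtains U \<phi> where "(U, \<phi>) \<in> A" "x \<in> U"
  using assms unfolding pts_def by blast

lemma smooth_intoE:
  assumes "smooth_into A S f" "x \<in> S"
  obtains V \<psi> W where "(V, \<psi>) \<in> A" "open W" "x \<in> W" "f ` (W \<inter> S) \<subseteq> V" "smooth_on (W \<inter> S) (\<psi> \<circ> f)"
proof -
  have "\<exists>(V, \<psi>)\<in>A. \<exists>W. open W \<and> x \<in> W \<and> f ` (W \<inter> S) \<subseteq> V \<and> smooth_on (W \<inter> S) (\<psi> \<circ> f)"
    using assms by (simp add: smooth_into_def)
  then show ?thesis
    using that by (elim bexE) (auto split: prod.splits)
qed

lemma smooth_intoI:
  assumes "\<And>x. x \<in> S \<Longrightarrow> \<exists>V \<psi> W. (V, \<psi>) \<in> A \<and> open W \<and> x \<in> W \<and> f ` (W \<inter> S) \<subseteq> V \<and>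
    smooth_on (W \<inter> S) (\<psi> \<circ> f)"
  shows "smooth_into A S f"
  unfolding smooth_into_def
proof
  fix x assume "x \<in> S"
  then obtain V \<psi> W where "(V, \<psi>) \<in> A"
    "open W \<and> x \<in> W \<and> f ` (W \<inter> S) \<subseteq> V \<and> smooth_on (W \<inter> S) (\<psi> \<circ> f)"
    using assms by metis
  then show "\<exists>(V, \<psi>)\<in>A. \<exists>W. open W \<and> x \<in> W \<and> f ` (W \<inter> S) \<subseteq> V \<and> smooth_on (W \<inter> S) (\<psi> \<circ> f)"
    by (intro bexI[of _ "(V, \<psi>)"]) auto
qed

lemma smooth_into_cong:
  assumes "smooth_into A S f" "\<And>x. x \<in> S \<Longrightarrow> f x = g x"
  shows "smooth_into A S g"
proof (rule smooth_intoI)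
  fix x assume "x \<in> S"
  obtain V \<psi> W where "(V, \<psi>) \<in> A" "open W" "x \<in> W" "f ` (W \<inter> S) \<subseteq> V" "smooth_on (W \<inter> S) (\<psi> \<circ> f)"
    using smooth_intoE[OF assms(1) \<open>x \<in> S\<close>] .
  moreover have "f ` (W \<inter> S) = g ` (W \<inter> S)" "smooth_on (W \<inter> S) (\<psi> \<circ> g)"
    using assms(2) calculation(5) by (auto intro: smooth_on_cong)
  ultimately show "\<exists>V \<psi> W. (V, \<psi>) \<in> A \<and> open W \<and> x \<in> W \<and> g ` (W \<inter> S) \<subseteq> V \<and>
      smooth_on (W \<inter> S) (\<psi> \<circ> g)"
    by metis
qed

lemma smooth_into_local:
  assumes "\<And>x. x \<in> S \<Longrightarrow> \<exists>W. open W \<and> x \<in> W \<and> smooth_into A (W \<inter> S) f"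
  shows "smooth_into A S f"
proof (rule smooth_intoI)
  fix x assume "x \<in> S"
  then obtain W' where W': "open W'" "x \<in> W'" "smooth_into A (W' \<inter> S) f"
    using assms by blast
  then obtain V \<psi> W where "(V, \<psi>) \<in> A" "open W" "x \<in> W" "f ` (W \<inter> (W' \<inter> S)) \<subseteq> V"
    "smooth_on (W \<inter> (W' \<inter> S)) (\<psi> \<circ> f)"
    using smooth_intoE[OF W'(3), of x] \<open>x \<in> S\<close> by blast
  then show "\<exists>V \<psi> W. (V, \<psi>) \<in> A \<and> open W \<and> x \<in> W \<and> f ` (W \<inter> S) \<subseteq> V \<and>
      smooth_on (W \<inter> S) (\<psi> \<circ> f)"
    using W' by (intro exI[of _ V] exI[of _ \<psi>] exI[of _ "W \<inter> W'"]) (auto simp: Int_assoc)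
qed

lemma smooth_into_mem: "smooth_into A S f \<Longrightarrow> x \<in> S \<Longrightarrow> f x \<in> X"
  by (erule (1) smooth_intoE) (metis IntI chart_subset image_subset_iff subsetD)

lemma smooth_into_continuous_on:
  assumes "smooth_into A S f"
  shows "continuous_on S f"
  unfolding continuous_on_eq_continuous_within
proof
  fix x assume "x \<in> S"
  obtain V \<psi> W where V: "(V, \<psi>) \<in> A" "open W" "x \<in> W" "f ` (W \<inter> S) \<subseteq> V"
    "smooth_on (W \<inter> S) (\<psi> \<circ> f)"
    using smooth_intoE[OF assms \<open>x \<in> S\<close>] .
  have "continuous_on (W \<inter> S) (inv_into V \<psi> \<circ> (\<psi> \<circ> f))"
    using V(4)
    by (intro continuous_on_compose[OF smooth_on_imp_continuous_on[OF V(5)]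
          continuous_on_subset[OF chart_inv_continuous[OF V(1)]]]) auto
  then have "continuous_on (W \<inter> S) f"
    by (rule continuous_on_eq) (use V in auto)
  moreover have "at x within (W \<inter> S) = at x within S"
    by (rule at_within_nhd[OF V(3,2)]) auto
  ultimately show "continuous (at x within S) f"
    using \<open>x \<in> S\<close> V(3) by (metis IntI continuous_on_eq_continuous_within)
qed

text \<open>Since coordinate changes are smooth, smoothness can be tested in any chart around the image
  point; the definition only provides one of them.\<close>

lemma smooth_into_in_chart:
  assumes f: "smooth_into A S f" and "x \<in> S" and V: "(V, \<psi>) \<in> A" "f x \<in> V"
  obtains W where "open W" "x \<in> W" "f ` (W \<inter> S) \<subseteq> V" "smooth_on (W \<inter> S) (\<psi> \<circ> f)"
proof -
  obtain V' \<psi>' W' where V': "(V', \<psi>') \<in> A" "open W'" "x \<in> W'" "f ` (W' \<inter> S) \<subseteq> V'"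
    "smooth_on (W' \<inter> S) (\<psi>' \<circ> f)"
    using smooth_intoE[OF f \<open>x \<in> S\<close>] .
  have "openin (top_of_set S) (S \<inter> f -` V)"
    by (rule continuous_openin_preimage[OF smooth_into_continuous_on[OF f] _ chart_openin[OF V(1)]])
      (use smooth_into_mem[OF f] in auto)
  then obtain T where T: "open T" "S \<inter> f -` V = S \<inter> T"
    by (metis openin_open)
  define W where "W = W' \<inter> T"
  have W: "open W" "x \<in> W" "f ` (W \<inter> S) \<subseteq> V' \<inter> V"
    using V' V T \<open>x \<in> S\<close> by (auto simp: W_def)
  have "smooth_on (W \<inter> S) ((\<psi> \<circ> inv_into V' \<psi>') \<circ> (\<psi>' \<circ> f))"
    using W transition_smooth[OF V'(1) V(1)]
    by (intro smooth_on_compose) (auto simp: W_def intro: smooth_on_subset[OF V'(5)])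
  then have "smooth_on (W \<inter> S) (\<psi> \<circ> f)"
    by (rule smooth_on_cong) (use W(3) V'(1) in auto)
  with W show ?thesis
    using that by blast
qed

lemma chart_inv_smooth_into: "(U, \<phi>) \<in> A \<Longrightarrow> smooth_into A (\<phi> ` U) (inv_into U \<phi>)"
  by (rule smooth_intoI)
    (use transition_smooth[of U \<phi> U \<phi>] in \<open>intro exI[of _ U] exI[of _ \<phi>] exI[of _ UNIV], auto\<close>)

lemma smooth_into_compose:
  fixes k :: "'e::real_normed_vector \<Rightarrow> 'f::euclidean_space"
  assumes k: "smooth_on S k" and g: "smooth_into A T g" and "k ` S \<subseteq> T"
  shows "smooth_into A S (g \<circ> k)"
proof (rule smooth_intoI)
  fix x assume "x \<in> S"
  then have "k x \<in> T"
    using assms(3) by blast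
  obtain V \<psi> W where V: "(V, \<psi>) \<in> A" "open W" "k x \<in> W" "g ` (W \<inter> T) \<subseteq> V"
    "smooth_on (W \<inter> T) (\<psi> \<circ> g)"
    using smooth_intoE[OF g \<open>k x \<in> T\<close>] .
  obtain W' where W': "open W'" "S \<inter> k -` W = S \<inter> W'"
    using continuous_openin_preimage_gen[OF smooth_on_imp_continuous_on[OF k] V(2)]
    by (metis openin_open)
  have "smooth_on (W' \<inter> S) ((\<psi> \<circ> g) \<circ> k)"
    using W' assms(3) by (intro smooth_on_compose[OF smooth_on_subset[OF k] V(5)]) auto
  moreover have "k y \<in> W \<inter> T" if "y \<in> W' \<inter> S" for y
    using that W'(2) assms(3) by blast
  then have "(g \<circ> k) ` (W' \<inter> S) \<subseteq> V"
    using V(4) by auto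
  ultimately show "\<exists>V \<psi> W. (V, \<psi>) \<in> A \<and> open W \<and> x \<in> W \<and> (g \<circ> k) ` (W \<inter> S) \<subseteq> V \<and>
      smooth_on (W \<inter> S) (\<psi> \<circ> (g \<circ> k))"
    using V(1,3) W' \<open>x \<in> S\<close>
    by (intro exI[of _ V] exI[of _ \<psi>] exI[of _ W']) (auto simp: o_assoc)
qed

text \<open>Locally \<open>g\<close> runs in one chart \<open>\<phi>\<close>, where \<open>F (\<tau> x) (g x)\<close> is the coordinate expression of the family
  applied to the pair \<open>(\<tau> x, \<phi> (g x))\<close>. All closure properties of smooth maps and isotopies that involve
  composition are instances: a single self-map is a family over a one-point parameter set, and an
  isotopy is a family over \<open>[0,1]\<close>.\<close>

lemma smooth_into_apply_family:
  fixes F :: "'p::euclidean_space \<Rightarrow> 'a \<Rightarrow> 'a" and g :: "'e::real_normed_vector \<Rightarrow> 'a"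
  assumes F: "\<And>U \<phi>. (U, \<phi>) \<in> A \<Longrightarrow> smooth_into A (P \<times> \<phi> ` U) (\<lambda>(t, y). F t (inv_into U \<phi> y))"
    and g: "smooth_into A S g" and \<tau>: "smooth_on S \<tau>" "\<tau> ` S \<subseteq> P"
  shows "smooth_into A S (\<lambda>x. F (\<tau> x) (g x))"
proof (rule smooth_into_local)
  fix x assume "x \<in> S"
  obtain U \<phi> W where U: "(U, \<phi>) \<in> A" "open W" "x \<in> W" "g ` (W \<inter> S) \<subseteq> U"
    "smooth_on (W \<inter> S) (\<phi> \<circ> g)"
    using smooth_intoE[OF g \<open>x \<in> S\<close>] .
  have "smooth_into A (W \<inter> S) ((\<lambda>(t, y). F t (inv_into U \<phi> y)) \<circ> (\<lambda>x. (\<tau> x, (\<phi> \<circ> g) x)))"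
    using U(4) \<tau>(2)
    by (intro smooth_into_compose[OF _ F[OF U(1)]] smooth_on_Pair U(5) smooth_on_subset[OF \<tau>(1)]) auto
  then have "smooth_into A (W \<inter> S) (\<lambda>x. F (\<tau> x) (g x))"
    by (rule smooth_into_cong) (use U(1,4) in auto)
  with U(2,3) show "\<exists>W. open W \<and> x \<in> W \<and> smooth_into A (W \<inter> S) (\<lambda>x. F (\<tau> x) (g x))"
    by blast
qed

lemma smooth_self_mapD:
  "smooth_self_map A f \<Longrightarrow> (U, \<phi>) \<in> A \<Longrightarrow> smooth_into A (\<phi> ` U) (f \<circ> inv_into U \<phi>)"
  unfolding smooth_self_map_def by blast

lemma smooth_into_snd:
  fixes S :: "'f::euclidean_space set"
  assumes "smooth_into A S g"
  shows "smooth_into A (P \<times> S) (\<lambda>(t::real, y). g y)"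
  by (rule smooth_into_cong[OF smooth_into_compose[of _ snd, OF smooth_on_bounded_linear assms]])
    (auto intro: bounded_linear_snd)

lemma smooth_into_self_map:
  assumes f: "smooth_self_map A f" and g: "smooth_into A S g"
  shows "smooth_into A S (f \<circ> g)"
proof -
  have "smooth_into A ({0::real} \<times> \<phi> ` U) (\<lambda>(t, y). (\<lambda>_. f) t (inv_into U \<phi> y))" if "(U, \<phi>) \<in> A" for U \<phi>
    using smooth_into_snd[OF smooth_self_mapD[OF f that]] by simp
  from smooth_into_apply_family[OF this g smooth_on_const[where c = 0]]
  show ?thesis
    by (simp add: o_def image_subset_iff)
qed

lemma smooth_into_family:
  assumes "smooth_family A F" "smooth_into A S g" "smooth_on S \<tau>" "\<tau> ` S \<subseteq> {0..1}"
  shows "smooth_into A S (\<lambda>x. F (\<tau> x) (g x))"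
proof (rule smooth_into_apply_family[OF _ assms(2-4)])
  show "smooth_into A ({0..1} \<times> \<phi> ` U) (\<lambda>(t, y). F t (inv_into U \<phi> y))" if "(U, \<phi>) \<in> A" for U \<phi>
    using bspec[OF assms(1)[unfolded smooth_family_def] that] by simp
qed

lemma smooth_self_mapI:
  assumes "\<And>U \<phi>. (U, \<phi>) \<in> A \<Longrightarrow> smooth_into A (\<phi> ` U) (f \<circ> inv_into U \<phi>)"
  shows "smooth_self_map A f"
  unfolding smooth_self_map_def using assms by blast

lemma inv_chart_mem: "(U, \<phi>) \<in> A \<Longrightarrow> y \<in> \<phi> ` U \<Longrightarrow> inv_into U \<phi> y \<in> X"
  by (rule subsetD[OF chart_subset inv_into_into])

lemma smooth_self_map_cong:
  assumes f: "smooth_self_map A f" and eq: "\<And>x. x \<in> X \<Longrightarrow> f x = g x"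
  shows "smooth_self_map A g"
proof (rule smooth_self_mapI)
  fix U \<phi> assume c: "(U, \<phi>) \<in> A"
  show "smooth_into A (\<phi> ` U) (g \<circ> inv_into U \<phi>)"
    by (rule smooth_into_cong[OF smooth_self_mapD[OF f c]]) (use inv_chart_mem[OF c] eq in auto)
qed

lemma smooth_self_map_id: "smooth_self_map A (\<lambda>x. x)"
  by (rule smooth_self_mapI) (use chart_inv_smooth_into in \<open>simp add: o_def\<close>)

lemma smooth_self_map_compose:
  "smooth_self_map A f \<Longrightarrow> smooth_self_map A g \<Longrightarrow> smooth_self_map A (f \<circ> g)"
  by (rule smooth_self_mapI) (simp add: comp_assoc smooth_into_self_map smooth_self_mapD)

lemma smooth_self_map_continuous_on:
  assumes f: "smooth_self_map A f"
  shows "continuous_on X f"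
proof -
  have "continuous (at x within X) f" if "x \<in> X" for x
  proof -
    obtain U \<phi> where c: "(U, \<phi>) \<in> A" "x \<in> U"
      using chart_at[OF \<open>x \<in> X\<close>] .
    have "continuous_on U ((f \<circ> inv_into U \<phi>) \<circ> \<phi>)"
      by (intro continuous_on_compose chart_continuous[OF c(1)]
          smooth_into_continuous_on[OF smooth_self_mapD[OF f c(1)]])
    then have "continuous_on U f"
      by (rule continuous_on_eq) (use c in auto)
    moreover obtain W where W: "open W" "U = X \<inter> W"
      using chart_openin[OF c(1)] by (auto simp: openin_open)
    have "at x within U = at x within X"
      by (rule at_within_nhd[of x W]) (use W c in auto)
    ultimately show ?thesis
      using c(2) by (metis continuous_on_eq_continuous_within)
  qed
  then show ?thesis
    by (simp add: continuous_on_eq_continuous_within)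
qed

section \<open>Orientations\<close>

text \<open>A point off the boundary has a positive second coordinate, and the open half-plane is open in the
  whole plane.\<close>

lemma chart_interior:
  assumes c: "(U, \<phi>) \<in> A" and x: "x \<in> U" "x \<notin> bdry A"
  shows "\<phi> x \<in> interior (\<phi> ` U)"
proof -
  obtain T where T: "open T" "\<phi> ` U = half_plane \<inter> T"
    using chart_image_openin[OF c] by (auto simp: openin_open)
  have "\<phi> x \<in> half_plane \<inter> T"
    using T(2) x(1) by blast
  moreover have "\<phi> x $ 2 \<noteq> 0"
    using c x unfolding bdry_def by blast
  ultimately have "\<phi> x \<in> {y. 0 < y $ 2} \<inter> T"
    by (auto simp: half_plane_def)
  moreover have "open ({y::real^2. 0 < y $ 2} \<inter> T)"
    using T(1) by (intro open_Int open_Collect_less continuous_intros)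
  moreover have "{y::real^2. 0 < y $ 2} \<inter> T \<subseteq> \<phi> ` U"
    unfolding T(2) by (auto simp: half_plane_def)
  ultimately show ?thesis
    by (meson interiorI)
qed

text \<open>Near an interior point, a smooth self-map is given by a map between open subsets of the plane; this
  makes the ordinary chain rule available for Jacobians.\<close>

lemma coordinate_expression:
  assumes f: "smooth_self_map A f" and c: "(U, \<phi>) \<in> A" "(V, \<psi>) \<in> A"
    and x: "x \<in> U" "x \<notin> bdry A" "f x \<in> V"
  obtains W where "open W" "\<phi> x \<in> W" "W \<subseteq> \<phi> ` U" "\<And>y. y \<in> W \<Longrightarrow> f (inv_into U \<phi> y) \<in> V"
    "(\<psi> \<circ> f \<circ> inv_into U \<phi>) differentiable (at (\<phi> x))"
proof -
  obtain W where W: "open W" "\<phi> x \<in> W" "(f \<circ> inv_into U \<phi>) ` (W \<inter> \<phi> ` U) \<subseteq> V"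
    "smooth_on (W \<inter> \<phi> ` U) (\<psi> \<circ> (f \<circ> inv_into U \<phi>))"
    by (rule smooth_into_in_chart[OF smooth_self_mapD[OF f c(1)] _ c(2), of "\<phi> x"]) (use c x in auto)
  have int: "\<phi> x \<in> interior (W \<inter> \<phi> ` U)"
    using chart_interior[OF c(1) x(1,2)] W(1,2) by (simp add: interior_open)
  have "(\<psi> \<circ> f \<circ> inv_into U \<phi>) differentiable (at (\<phi> x))"
    using smooth_on_differentiable_interior[OF W(4) int] by (simp add: o_assoc)
  moreover have "W \<inter> interior (\<phi> ` U) \<subseteq> \<phi> ` U" "\<phi> x \<in> W \<inter> interior (\<phi> ` U)"
    using interior_subset chart_interior[OF c(1) x(1,2)] W(2) by auto
  moreover have "f (inv_into U \<phi> y) \<in> V" if "y \<in> W \<inter> interior (\<phi> ` U)" for y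
  proof -
    have "y \<in> W \<inter> \<phi> ` U"
      using that interior_subset by blast
    then show ?thesis
      using W(3) by auto
  qed
  ultimately show ?thesis
    using that[of "W \<inter> interior (\<phi> ` U)"] W(1) by blast
qed

text \<open>The map \<open>h\<close> is only required to agree with the composition on the surface, because the elements of
  the diffeomorphism group are extensional functions and their products are restricted compositions.\<close>

lemma jacobian_compose:
  assumes f: "smooth_self_map A f" and g: "smooth_self_map A g"
    and c: "(U, \<phi>) \<in> A" "(V, \<psi>) \<in> A" "(V', \<psi>') \<in> A"
    and x: "x \<in> U" "x \<notin> bdry A" "f x \<in> V" "f x \<notin> bdry A" "g (f x) \<in> V'"
    and h: "\<And>x. x \<in> X \<Longrightarrow> h x = g (f x)"
  shows "jacobian (U, \<phi>) (V', \<psi>') h x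
    = jacobian (V, \<psi>) (V', \<psi>') g (f x) * jacobian (U, \<phi>) (V, \<psi>) f x"
proof -
  let ?F = "\<psi> \<circ> f \<circ> inv_into U \<phi>" and ?G = "\<psi>' \<circ> g \<circ> inv_into V \<psi>" and ?H = "\<psi>' \<circ> h \<circ> inv_into U \<phi>"
  obtain W where W: "open W" "\<phi> x \<in> W" "W \<subseteq> \<phi> ` U" "\<And>y. y \<in> W \<Longrightarrow> f (inv_into U \<phi> y) \<in> V"
    and dF: "?F differentiable (at (\<phi> x))"
    using coordinate_expression[OF f c(1,2) x(1-3)] by metis
  have Fx: "?F (\<phi> x) = \<psi> (f x)"
    using c(1) x(1) by simp
  have dG: "?G differentiable (at (?F (\<phi> x)))"
    unfolding Fx using coordinate_expression[OF g c(2,3) x(3-5)] by metis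
  have eq: "?H y = (?G \<circ> ?F) y" if "y \<in> W" for y
  proof -
    have "inv_into U \<phi> y \<in> X"
      using that W(3) inv_chart_mem[OF c(1)] by blast
    then show ?thesis
      using W(4)[OF that] c(2) h by simp
  qed
  have "frechet_derivative ?H (at (\<phi> x)) = frechet_derivative (?G \<circ> ?F) (at (\<phi> x))"
    by (rule frechet_derivative_cong_open[OF W(1,2)]) (rule eq)
  also have "\<dots> = frechet_derivative ?G (at (?F (\<phi> x))) \<circ> frechet_derivative ?F (at (\<phi> x))"
    by (rule frechet_derivative_compose[OF dF dG])
  finally have "matrix (frechet_derivative ?H (at (\<phi> x))) =
      matrix (frechet_derivative ?G (at (?F (\<phi> x)))) ** matrix (frechet_derivative ?F (at (\<phi> x)))"
    using matrix_compose[OF linear_frechet_derivative[OF dF] linear_frechet_derivative[OF dG]] by simp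
  then show ?thesis
    by (simp only: jacobian_def prod.case Fx det_mul)
qed

lemma bdry_subset: "bdry A \<subseteq> X"
  unfolding bdry_def pts_def by blast

lemma orientation_preservingD:
  "orientation_preserving A f \<Longrightarrow> (U, \<phi>) \<in> A \<Longrightarrow> (V, \<psi>) \<in> A \<Longrightarrow> x \<in> U \<Longrightarrow> x \<notin> bdry A \<Longrightarrow>
    f x \<in> V \<Longrightarrow> f x \<notin> bdry A \<Longrightarrow> jacobian (U, \<phi>) (V, \<psi>) f x > 0"
  unfolding orientation_preserving_def by fastforce

lemma orientation_preservingI:
  assumes "\<And>U \<phi> V \<psi> x. (U, \<phi>) \<in> A \<Longrightarrow> (V, \<psi>) \<in> A \<Longrightarrow> x \<in> U \<Longrightarrow> x \<notin> bdry A \<Longrightarrow>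
    f x \<in> V \<Longrightarrow> f x \<notin> bdry A \<Longrightarrow> jacobian (U, \<phi>) (V, \<psi>) f x > 0"
  shows "orientation_preserving A f"
  unfolding orientation_preserving_def using assms by auto

lemma orientation_preserving_id: "orientation_preserving A (\<lambda>x. x)"
  using oriented by (simp add: oriented_atlas_def)

lemma orientation_preserving_compose:
  assumes f: "smooth_self_map A f" "orientation_preserving A f"
    and g: "smooth_self_map A g" "orientation_preserving A g"
    and fX: "\<And>x. x \<in> X - bdry A \<Longrightarrow> f x \<in> X - bdry A"
    and h: "\<And>x. x \<in> X \<Longrightarrow> h x = g (f x)"
  shows "orientation_preserving A h"
proof (rule orientation_preservingI)
  fix U \<phi> V' \<psi>' x
  assume *: "(U, \<phi>) \<in> A" "(V', \<psi>') \<in> A" "x \<in> U" "x \<notin> bdry A" "h x \<in> V'" "h x \<notin> bdry A"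
  have x: "x \<in> X"
    using *(1,3) chart_subset by blast
  then have fx: "f x \<in> X" "f x \<notin> bdry A"
    using fX * by auto
  obtain V \<psi> where V: "(V, \<psi>) \<in> A" "f x \<in> V"
    using chart_at[OF fx(1)] .
  have gfx: "g (f x) \<in> V'" "g (f x) \<notin> bdry A"
    using * h[OF x] by auto
  have "jacobian (U, \<phi>) (V', \<psi>') h x
    = jacobian (V, \<psi>) (V', \<psi>') g (f x) * jacobian (U, \<phi>) (V, \<psi>) f x"
    by (rule jacobian_compose[OF f(1) g(1) *(1) V(1) *(2) *(3,4) V(2) fx(2) gfx(1) h])
  then show "jacobian (U, \<phi>) (V', \<psi>') h x > 0"
    using orientation_preservingD[OF f(2) *(1) V(1) *(3,4) V(2) fx(2)]
      orientation_preservingD[OF g(2) V(1) *(2) V(2) fx(2) gfx] by simp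
qed

text \<open>The Jacobians of \<open>f\<close> and \<open>h\<close> at corresponding points multiply to that of the identity, which is
  positive because the atlas is oriented.\<close>

lemma orientation_preserving_inverse:
  assumes f: "smooth_self_map A f" "orientation_preserving A f" and h: "smooth_self_map A h"
    and inv: "\<And>x. x \<in> X \<Longrightarrow> f (h x) = x"
  shows "orientation_preserving A h"
proof (rule orientation_preservingI)
  fix U \<phi> V \<psi> x
  assume *: "(U, \<phi>) \<in> A" "(V, \<psi>) \<in> A" "x \<in> U" "x \<notin> bdry A" "h x \<in> V" "h x \<notin> bdry A"
  have x: "f (h x) = x"
    using *(1,3) chart_subset inv by blast
  have fhx: "f (h x) \<in> U" "f (h x) \<notin> bdry A"
    using * x by auto
  have "0 < jacobian (U, \<phi>) (U, \<phi>) (\<lambda>x. x) x"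
    by (rule orientation_preservingD[OF orientation_preserving_id *(1) *(1) *(3,4) *(3,4)])
  also have "\<dots> = jacobian (V, \<psi>) (U, \<phi>) f (h x) * jacobian (U, \<phi>) (V, \<psi>) h x"
    by (rule jacobian_compose[OF h f(1) *(1,2) *(1) *(3-6) fhx(1)]) (simp add: inv)
  finally show "jacobian (U, \<phi>) (V, \<psi>) h x > 0"
    using orientation_preservingD[OF f(2) *(2) *(1) *(5,6) fhx] by (simp add: zero_less_mult_iff)
qed


section \<open>The mapping class group\<close>

lemma diffeosI:
  assumes "f \<in> Bij X" "smooth_self_map A f" "smooth_self_map A (inv_into X f)"
    "orientation_preserving A f" "\<And>x. x \<in> bdry A \<Longrightarrow> f x = x"
  shows "f \<in> diffeos A"
  using assms by (simp add: diffeos_def)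

lemma
  assumes "f \<in> diffeos A"
  shows diffeo_Bij: "f \<in> Bij X" and diffeo_smooth: "smooth_self_map A f"
    and diffeo_inv_smooth: "smooth_self_map A (inv_into X f)"
    and diffeo_orientation_preserving: "orientation_preserving A f"
    and diffeo_bdry: "x \<in> bdry A \<Longrightarrow> f x = x"
  using assms by (auto simp: diffeos_def)

lemma diffeo_bij_betw: "f \<in> diffeos A \<Longrightarrow> bij_betw f X X"
  using diffeo_Bij by (simp add: Bij_def)

lemma diffeo_inj_on: "f \<in> diffeos A \<Longrightarrow> inj_on f X"
  by (rule bij_betw_imp_inj_on[OF diffeo_bij_betw])

lemma diffeo_mem: "f \<in> diffeos A \<Longrightarrow> x \<in> X \<Longrightarrow> f x \<in> X"
  by (rule bij_betw_apply[OF diffeo_bij_betw])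

lemma diffeo_f_inv [simp]: "f \<in> diffeos A \<Longrightarrow> x \<in> X \<Longrightarrow> f (inv_into X f x) = x"
  by (rule bij_betw_inv_into_right[OF diffeo_bij_betw])

lemma diffeo_inv_f [simp]: "f \<in> diffeos A \<Longrightarrow> x \<in> X \<Longrightarrow> inv_into X f (f x) = x"
  by (rule bij_betw_inv_into_left[OF diffeo_bij_betw])

lemma diffeo_inv_mem: "f \<in> diffeos A \<Longrightarrow> x \<in> X \<Longrightarrow> inv_into X f x \<in> X"
  by (rule Bij_inv_into_mem[OF diffeo_Bij])

text \<open>Since \<open>f\<close> is injective and fixes each boundary point, no interior point can be sent to the
  boundary. This replaces an appeal to invariance of domain.\<close>

lemma diffeo_interior: "f \<in> diffeos A \<Longrightarrow> x \<in> X - bdry A \<Longrightarrow> f x \<in> X - bdry A"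
proof
  assume f: "f \<in> diffeos A" "x \<in> X - bdry A"
  show "f x \<in> X"
    using f diffeo_mem by blast
  show "f x \<notin> bdry A"
  proof
    assume b: "f x \<in> bdry A"
    then have "f (f x) = f x"
      using diffeo_bdry[OF f(1)] by blast
    then have "f x = x"
      using f diffeo_mem inj_onD[OF diffeo_inj_on[OF f(1)]] by blast
    with b f(2) show False
      by simp
  qed
qed

lemma diffeo_compose:
  assumes g: "g \<in> diffeos A" and f: "f \<in> diffeos A"
  shows "compose X g f \<in> diffeos A"
proof (rule diffeosI)
  show bij: "compose X g f \<in> Bij X"
    by (intro compose_Bij diffeo_Bij assms)
  show "smooth_self_map A (compose X g f)"
    by (rule smooth_self_map_cong[OF smooth_self_map_compose[OF diffeo_smooth[OF g] diffeo_smooth[OF f]]])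
      (simp add: compose_eq)
  have "inv_into X (compose X g f) x = inv_into X f (inv_into X g x)" if "x \<in> X" for x
    using bij that by (intro inv_into_f_eq)
      (auto simp: Bij_def bij_betw_def compose_eq diffeo_inv_mem f g)
  then show "smooth_self_map A (inv_into X (compose X g f))"
    by (intro smooth_self_map_cong[OF smooth_self_map_compose[OF diffeo_inv_smooth[OF f]
          diffeo_inv_smooth[OF g]]]) simp
  show "orientation_preserving A (compose X g f)"
    by (rule orientation_preserving_compose[OF diffeo_smooth[OF f] diffeo_orientation_preserving[OF f]
          diffeo_smooth[OF g] diffeo_orientation_preserving[OF g] diffeo_interior[OF f]])
      (simp_all add: compose_eq)
  show "compose X g f x = x" if "x \<in> bdry A" for x
    using that bdry_subset by (auto simp: compose_eq diffeo_bdry f g)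
qed

lemma diffeo_id: "(\<lambda>x\<in>X. x) \<in> diffeos A"
proof (rule diffeosI)
  show "(\<lambda>x\<in>X. x) \<in> Bij X"
    by (rule id_Bij)
  show "smooth_self_map A (\<lambda>x\<in>X. x)"
    by (rule smooth_self_map_cong[OF smooth_self_map_id]) simp
  show "smooth_self_map A (inv_into X (\<lambda>x\<in>X. x))"
    by (rule smooth_self_map_cong[OF smooth_self_map_id])
      (simp add: inv_into_f_eq inj_on_def)
  show "orientation_preserving A (\<lambda>x\<in>X. x)"
    by (rule orientation_preserving_inverse[OF smooth_self_map_id orientation_preserving_id])
      (auto intro: smooth_self_map_cong[OF smooth_self_map_id])
  show "(\<lambda>x\<in>X. x) x = x" if "x \<in> bdry A" for x
    using that bdry_subset by auto
qed

lemma diffeo_inverse: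
  assumes f: "f \<in> diffeos A"
  shows "restrict (inv_into X f) X \<in> diffeos A"
proof (rule diffeosI)
  show bij: "restrict (inv_into X f) X \<in> Bij X"
    by (rule restrict_inv_into_Bij[OF diffeo_Bij[OF f]])
  show smooth: "smooth_self_map A (restrict (inv_into X f) X)"
    by (rule smooth_self_map_cong[OF diffeo_inv_smooth[OF f]]) simp
  have "inv_into X (restrict (inv_into X f) X) x = f x" if "x \<in> X" for x
    using bij that by (intro inv_into_f_eq) (auto simp: Bij_def bij_betw_def diffeo_mem f)
  then show "smooth_self_map A (inv_into X (restrict (inv_into X f) X))"
    by (intro smooth_self_map_cong[OF diffeo_smooth[OF f]]) simp
  show "orientation_preserving A (restrict (inv_into X f) X)"
    by (rule orientation_preserving_inverse[OF diffeo_smooth[OF f] diffeo_orientation_preserving[OF f] smooth])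
      (simp add: f)
  show "restrict (inv_into X f) X x = x" if "x \<in> bdry A" for x
  proof -
    have "x \<in> X"
      using that bdry_subset by blast
    then show ?thesis
      using diffeo_inv_f[OF f, of x] diffeo_bdry[OF f that] by simp
  qed
qed

lemma subgroup_diffeos: "subgroup (diffeos A) (BijGroup X)"
proof (rule subgroup.intro)
  show "diffeos A \<subseteq> carrier (BijGroup X)"
    using diffeo_Bij by (auto simp: BijGroup_def)
  show "f \<otimes>\<^bsub>BijGroup X\<^esub> g \<in> diffeos A" if "f \<in> diffeos A" "g \<in> diffeos A" for f g
    using that diffeo_compose diffeo_Bij by (simp add: BijGroup_def)
  show "\<one>\<^bsub>BijGroup X\<^esub> \<in> diffeos A"
    using diffeo_id by (simp add: BijGroup_def)
  show "inv\<^bsub>BijGroup X\<^esub> f \<in> diffeos A" if "f \<in> diffeos A" for f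
    using that diffeo_inverse diffeo_Bij by (simp add: inv_BijGroup)
qed

lemma group_diffeo_group: "group (diffeo_group A)"
  unfolding diffeo_group_def by (rule group.subgroup_imp_group[OF group_BijGroup subgroup_diffeos])

sublocale diffeo: group "diffeo_group A"
  by (rule group_diffeo_group)

lemma carrier_diffeo_group [simp]: "carrier (diffeo_group A) = diffeos A"
  by (simp add: diffeo_group_def)

lemma diffeo_group_mult:
  "f \<in> diffeos A \<Longrightarrow> g \<in> diffeos A \<Longrightarrow> f \<otimes>\<^bsub>diffeo_group A\<^esub> g = compose X f g"
  using diffeo_Bij by (simp add: diffeo_group_def BijGroup_def)

lemma diffeo_group_one: "\<one>\<^bsub>diffeo_group A\<^esub> = (\<lambda>x\<in>X. x)"
  by (simp add: diffeo_group_def BijGroup_def)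

lemma smooth_familyI:
  assumes "\<And>U \<phi>. (U, \<phi>) \<in> A \<Longrightarrow> smooth_into A ({0..1} \<times> \<phi> ` U) (\<lambda>(t, y). F t (inv_into U \<phi> y))"
  shows "smooth_family A F"
  unfolding smooth_family_def using assms by auto

lemma smooth_familyD:
  "smooth_family A F \<Longrightarrow> (U, \<phi>) \<in> A \<Longrightarrow>
    smooth_into A ({0..1} \<times> \<phi> ` U) (\<lambda>(t, y). F t (inv_into U \<phi> y))"
  unfolding smooth_family_def by auto

lemma smooth_family_const: "smooth_self_map A f \<Longrightarrow> smooth_family A (\<lambda>_. f)"
  by (rule smooth_familyI) (use smooth_into_snd[OF smooth_self_mapD] in simp)

lemma smooth_family_cong:
  assumes F: "smooth_family A F" and eq: "\<And>t x. t \<in> {0..1} \<Longrightarrow> x \<in> X \<Longrightarrow> F t x = G t x"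
  shows "smooth_family A G"
proof (rule smooth_familyI)
  fix U \<phi> assume c: "(U, \<phi>) \<in> A"
  show "smooth_into A ({0..1} \<times> \<phi> ` U) (\<lambda>(t, y). G t (inv_into U \<phi> y))"
    by (rule smooth_into_cong[OF smooth_familyD[OF F c]]) (use inv_chart_mem[OF c] eq in auto)
qed

lemma smooth_family_compose:
  assumes F: "smooth_family A F" and G: "smooth_family A G"
  shows "smooth_family A (\<lambda>t x. F t (G t x))"
proof (rule smooth_familyI)
  fix U \<phi> assume c: "(U, \<phi>) \<in> A"
  have "smooth_into A ({0..1} \<times> \<phi> ` U) (\<lambda>x. F (fst x) ((\<lambda>(t, y). G t (inv_into U \<phi> y)) x))"
    by (rule smooth_into_family[OF F smooth_familyD[OF G c] smooth_on_bounded_linear[OF bounded_linear_fst]])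
      auto
  then show "smooth_into A ({0..1} \<times> \<phi> ` U) (\<lambda>(t, y). F t (G t (inv_into U \<phi> y)))"
    by (simp add: case_prod_unfold)
qed

lemma smooth_family_reverse:
  assumes F: "smooth_family A F"
  shows "smooth_family A (\<lambda>t. F (1 - t))"
proof (rule smooth_familyI)
  fix U \<phi> assume c: "(U, \<phi>) \<in> A"
  have "smooth_into A ({0..1} \<times> \<phi> ` U)
      (\<lambda>x. F ((\<lambda>(t, y). 1 - t) x) ((\<lambda>(t, y). inv_into U \<phi> y) x))"
    by (rule smooth_into_family[OF F smooth_into_snd[OF chart_inv_smooth_into[OF c]] smooth_on_reflect]) auto
  then show "smooth_into A ({0..1} \<times> \<phi> ` U) (\<lambda>(t, y). F (1 - t) (inv_into U \<phi> y))"
    by (simp add: case_prod_unfold)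
qed

lemma isotopic_to_idI:
  assumes "smooth_family A F" "\<And>t. t \<in> {0..1} \<Longrightarrow> F t \<in> diffeos A" "F 0 = \<one>\<^bsub>diffeo_group A\<^esub>" "F 1 = f"
  shows "f \<in> isotopic_to_id A"
  using assms unfolding isotopic_to_id_def by blast

lemma isotopic_to_idE:
  assumes "f \<in> isotopic_to_id A"
  obtains F where "smooth_family A F" "\<And>t. t \<in> {0..1} \<Longrightarrow> F t \<in> diffeos A"
    "F 0 = \<one>\<^bsub>diffeo_group A\<^esub>" "F 1 = f"
  using assms unfolding isotopic_to_id_def by blast

lemma isotopic_to_id_subset: "isotopic_to_id A \<subseteq> diffeos A"
  by (auto elim!: isotopic_to_idE)

lemma smooth_family_mult:
  assumes "smooth_family A F" "\<And>t. t \<in> {0..1} \<Longrightarrow> F t \<in> diffeos A"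
    and "smooth_family A G" "\<And>t. t \<in> {0..1} \<Longrightarrow> G t \<in> diffeos A"
  shows "smooth_family A (\<lambda>t. F t \<otimes>\<^bsub>diffeo_group A\<^esub> G t)"
  by (rule smooth_family_cong[OF smooth_family_compose[OF assms(1,3)]])
    (simp add: diffeo_group_mult assms compose_eq)

text \<open>Given isotopies \<open>F\<close> and \<open>G\<close> from the identity to \<open>f\<close> and \<open>g\<close>, the products \<open>F\<^sub>t G\<^sub>t\<close>, \<open>F\<^bsub>1-t\<^esub> f\<inverse>\<close> and
  \<open>h F\<^sub>t h\<inverse>\<close> in the diffeomorphism group are isotopies from the identity to \<open>fg\<close>, \<open>f\<inverse>\<close> and \<open>h f h\<inverse>\<close>.\<close>

lemma normal_isotopic_to_id: "isotopic_to_id A \<lhd> diffeo_group A"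
proof (rule diffeo.normal_invI)
  show "subgroup (isotopic_to_id A) (diffeo_group A)"
  proof (rule subgroup.intro)
    show "isotopic_to_id A \<subseteq> carrier (diffeo_group A)"
      using isotopic_to_id_subset by simp
    show "\<one>\<^bsub>diffeo_group A\<^esub> \<in> isotopic_to_id A"
      by (rule isotopic_to_idI[of "\<lambda>_. \<one>\<^bsub>diffeo_group A\<^esub>"])
        (auto simp: diffeo_group_one diffeo_id smooth_family_const[OF diffeo_smooth[OF diffeo_id]])
  next
    fix f g assume "f \<in> isotopic_to_id A" "g \<in> isotopic_to_id A"
    then obtain F G where F: "smooth_family A F" "\<And>t. t \<in> {0..1} \<Longrightarrow> F t \<in> diffeos A"
        "F 0 = \<one>\<^bsub>diffeo_group A\<^esub>" "F 1 = f"
      and G: "smooth_family A G" "\<And>t. t \<in> {0..1} \<Longrightarrow> G t \<in> diffeos A"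
        "G 0 = \<one>\<^bsub>diffeo_group A\<^esub>" "G 1 = g"
      by (elim isotopic_to_idE) blast
    show "f \<otimes>\<^bsub>diffeo_group A\<^esub> g \<in> isotopic_to_id A"
      by (rule isotopic_to_idI[OF smooth_family_mult[OF F(1,2) G(1,2)]])
        (use F G diffeo.m_closed diffeo.l_one[OF diffeo.one_closed] in auto)
  next
    fix f assume "f \<in> isotopic_to_id A"
    then obtain F where F: "smooth_family A F" "\<And>t. t \<in> {0..1} \<Longrightarrow> F t \<in> diffeos A"
        "F 0 = \<one>\<^bsub>diffeo_group A\<^esub>" "F 1 = f"
      by (elim isotopic_to_idE) blast
    have f: "f \<in> diffeos A"
      using F(2)[of 1] F(4) by simp
    have inv: "inv\<^bsub>diffeo_group A\<^esub> f \<in> diffeos A"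
      using diffeo.inv_closed[of f] f by simp
    have rev: "F (1 - t) \<in> diffeos A" if "t \<in> {0..1}" for t
      using F(2)[of "1 - t"] that by auto
    show "inv\<^bsub>diffeo_group A\<^esub> f \<in> isotopic_to_id A"
      by (rule isotopic_to_idI[OF smooth_family_mult[OF smooth_family_reverse[OF F(1)] rev
              smooth_family_const[OF diffeo_smooth[OF inv]] inv]])
        (use F f inv rev diffeo.m_closed diffeo.r_inv[of f] diffeo.l_one in auto)
  qed
next
  fix f h assume f: "f \<in> carrier (diffeo_group A)" and "h \<in> isotopic_to_id A"
  then obtain F where F: "smooth_family A F" "\<And>t. t \<in> {0..1} \<Longrightarrow> F t \<in> diffeos A"
      "F 0 = \<one>\<^bsub>diffeo_group A\<^esub>" "F 1 = h"
    by (elim isotopic_to_idE) blast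
  have f': "f \<in> diffeos A" "inv\<^bsub>diffeo_group A\<^esub> f \<in> diffeos A"
    using diffeo.inv_closed[of f] f by auto
  have closed: "f \<otimes>\<^bsub>diffeo_group A\<^esub> F t \<in> diffeos A" if "t \<in> {0..1}" for t
    using diffeo.m_closed[of f "F t"] F(2)[OF that] f' by simp
  show "f \<otimes>\<^bsub>diffeo_group A\<^esub> h \<otimes>\<^bsub>diffeo_group A\<^esub> inv\<^bsub>diffeo_group A\<^esub> f \<in> isotopic_to_id A"
    by (rule isotopic_to_idI[OF smooth_family_mult[OF smooth_family_mult[OF
              smooth_family_const[OF diffeo_smooth[OF f'(1)]] f'(1) F(1,2)] closed
              smooth_family_const[OF diffeo_smooth[OF f'(2)]] f'(2)]])
      (use F f f' closed diffeo.m_closed diffeo.r_inv[of f] in auto)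
qed

sublocale isotopy: normal "isotopic_to_id A" "diffeo_group A"
  by (rule normal_isotopic_to_id)

lemma group_mcg: "group (mcg A)"
  unfolding mcg_def by (rule isotopy.factorgroup_is_group)

section \<open>The action on BFK-diagrams\<close>

lemma embedded_circleD:
  assumes "embedded_circle A c"
  shows "smooth_into A circle c" "inj_on c circle"
    "(V, \<psi>) \<in> A \<Longrightarrow> c (cis \<theta>) \<in> V \<Longrightarrow> vector_derivative (\<lambda>s. \<psi> (c (cis s))) (at \<theta>) \<noteq> 0"
  using assms unfolding embedded_circle_def by auto

lemma embedded_circleI:
  assumes "smooth_into A circle c" "inj_on c circle"
    "\<And>V \<psi> \<theta>. (V, \<psi>) \<in> A \<Longrightarrow> c (cis \<theta>) \<in> V \<Longrightarrow> vector_derivative (\<lambda>s. \<psi> (c (cis s))) (at \<theta>) \<noteq> 0"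
  shows "embedded_circle A c"
  using assms unfolding embedded_circle_def by auto

lemma loop_in_chart:
  assumes c: "smooth_into A circle c" and V: "(V, \<psi>) \<in> A" "c (cis \<theta>) \<in> V"
  obtains W where "open W" "\<theta> \<in> W" "\<And>s. s \<in> W \<Longrightarrow> c (cis s) \<in> V"
    "continuous_on W (\<lambda>s. \<psi> (c (cis s)))" "(\<lambda>s. \<psi> (c (cis s))) differentiable (at \<theta>)"
proof -
  have "smooth_into A UNIV (c \<circ> cis)"
    by (rule smooth_into_compose[OF smooth_on_cis c]) auto
  then obtain W where W: "open W" "\<theta> \<in> W" "(c \<circ> cis) ` (W \<inter> UNIV) \<subseteq> V"
    "smooth_on (W \<inter> UNIV) (\<psi> \<circ> (c \<circ> cis))"
    by (rule smooth_into_in_chart[OF _ UNIV_I V(1)]) (use V(2) in auto)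
  have "\<theta> \<in> interior W"
    using W(1,2) by (simp add: interior_open)
  then show ?thesis
    using that[of W] W smooth_on_imp_continuous_on[OF W(4)]
      smooth_on_differentiable_interior[OF W(4), of \<theta>] by (auto simp: o_def)
qed

text \<open>The velocity of \<open>f \<circ> c\<close> cannot vanish: in coordinates, \<open>c\<close> is recovered from \<open>f \<circ> c\<close> by applying a
  differentiable extension \<open>m\<close> of the coordinate expression of \<open>f\<inverse>\<close>, so the velocity of \<open>c\<close> would vanish
  as well. Because an extension suffices, loops that touch the boundary need no separate treatment.\<close>

lemma embedded_circle_image:
  assumes f: "f \<in> diffeos A" and c: "embedded_circle A c"
  shows "embedded_circle A (f \<circ> c)"
proof (rule embedded_circleI)
  note c_smooth = embedded_circleD(1)[OF c]
  have c_mem: "c z \<in> X" if "z \<in> circle" for z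
    using smooth_into_mem[OF c_smooth that] .
  show fc: "smooth_into A circle (f \<circ> c)"
    by (rule smooth_into_self_map[OF diffeo_smooth[OF f] c_smooth])
  show "inj_on (f \<circ> c) circle"
    using c_mem by (intro comp_inj_on embedded_circleD(2)[OF c] inj_on_subset[OF diffeo_inj_on[OF f]]) auto
  fix V' \<psi>' \<theta> assume V': "(V', \<psi>') \<in> A" "(f \<circ> c) (cis \<theta>) \<in> V'"
  define k where "k = (\<lambda>s. \<psi>' ((f \<circ> c) (cis s)))"
  obtain W' where W': "open W'" "\<theta> \<in> W'" "\<And>s. s \<in> W' \<Longrightarrow> (f \<circ> c) (cis s) \<in> V'"
    "continuous_on W' k" "k differentiable (at \<theta>)"
    using loop_in_chart[OF fc V'] unfolding k_def by metis
  have "c (cis \<theta>) \<in> X"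
    by (rule c_mem) simp
  then obtain V \<psi> where V: "(V, \<psi>) \<in> A" "c (cis \<theta>) \<in> V"
    by (rule chart_at)
  define q where "q = \<psi> \<circ> (inv_into X f \<circ> inv_into V' \<psi>')"
  have k_mem: "k s \<in> \<psi>' ` V'" and qk: "q (k s) = \<psi> (c (cis s))" if "s \<in> W'" for s
    using W'(3)[OF that] V'(1) f c_mem by (auto simp: k_def q_def)
  obtain T where T: "open T" "k \<theta> \<in> T" "smooth_on (T \<inter> \<psi>' ` V') q"
    unfolding q_def
  proof (rule smooth_into_in_chart[OF smooth_self_mapD[OF diffeo_inv_smooth[OF f] V'(1)] k_mem[OF W'(2)] V(1)])
    show "(inv_into X f \<circ> inv_into V' \<psi>') (k \<theta>) \<in> V"
      using V V' f c_mem by (simp add: k_def)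
  qed blast
  obtain M m where M: "open M" "k \<theta> \<in> M" "m differentiable (at (k \<theta>))"
    "\<And>y. y \<in> M \<Longrightarrow> y \<in> T \<inter> \<psi>' ` V' \<Longrightarrow> m y = q y"
    using smooth_on_extension_differentiable[OF T(3)] T(2) k_mem[OF W'(2)] by (metis IntI)
  \<comment> \<open>Parameters at which the loop stays where \<open>m\<close> extends \<open>q\<close>, the coordinate expression of \<open>f\<inverse>\<close>.\<close>
  let ?N = "W' \<inter> k -` (M \<inter> T)"
  have N: "open ?N" "\<theta> \<in> ?N"
    using continuous_open_preimage[OF W'(4,1) open_Int[OF M(1) T(1)]] W'(2) M(2) T(2) by auto
  have mk: "(m \<circ> k) s = \<psi> (c (cis s))" if "s \<in> ?N" for s
    using that M(4)[of "k s"] k_mem qk by auto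
  show "vector_derivative (\<lambda>s. \<psi>' ((f \<circ> c) (cis s))) (at \<theta>) \<noteq> 0"
  proof
    assume "vector_derivative (\<lambda>s. \<psi>' ((f \<circ> c) (cis s))) (at \<theta>) = 0"
    then have dk: "(k has_derivative (\<lambda>_. 0)) (at \<theta>)"
      using W'(5) unfolding vector_derivative_works k_def[symmetric] has_vector_derivative_def by simp
    obtain m' where m': "(m has_derivative m') (at (k \<theta>))"
      using M(3) by (auto simp: differentiable_def)
    have "(m \<circ> k has_derivative m' \<circ> (\<lambda>_. 0)) (at \<theta>)"
      by (rule diff_chain_at[OF dk m'])
    then have "(m \<circ> k has_derivative (\<lambda>_. 0)) (at \<theta>)"
      using linear_0[OF has_derivative_linear[OF m']] by (simp add: o_def)
    then have "((\<lambda>s. \<psi> (c (cis s))) has_derivative (\<lambda>_. 0)) (at \<theta>)"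
      by (rule has_derivative_transform_within_open[OF _ N]) (rule mk)
    then have "((\<lambda>s. \<psi> (c (cis s))) has_vector_derivative 0) (at \<theta>)"
      by (simp add: has_vector_derivative_def)
    then show False
      using embedded_circleD(3)[OF c V] vector_derivative_at by blast
  qed
qed

lemma loop_subset: "embedded_circle A c \<Longrightarrow> c ` circle \<subseteq> X"
  using smooth_into_mem[OF embedded_circleD(1)] by blast

text \<open>A contraction of \<open>f \<circ> c\<close> would be carried by \<open>f\<inverse>\<close> to a contraction of \<open>c\<close>.\<close>

lemma nontrivial_loop_image:
  assumes f: "f \<in> diffeos A" and "nontrivial_loop A C"
  shows "nontrivial_loop A (f ` C)"
proof -
  obtain c where c: "embedded_circle A c" "C = c ` circle"
    and nontrivial: "\<not> (\<exists>a. homotopic_with_canon (\<lambda>_. True) circle X c (\<lambda>_. a))"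
    using assms(2) unfolding nontrivial_loop_def by blast
  have c_mem: "c z \<in> X" if "z \<in> circle" for z
    using loop_subset[OF c(1)] that by blast
  have "\<not> homotopic_with_canon (\<lambda>_. True) circle X (f \<circ> c) (\<lambda>_. a)" for a
  proof
    assume "homotopic_with_canon (\<lambda>_. True) circle X (f \<circ> c) (\<lambda>_. a)"
    then have "homotopic_with_canon (\<lambda>_. True) circle X (inv_into X f \<circ> (f \<circ> c)) (inv_into X f \<circ> (\<lambda>_. a))"
      by (rule homotopic_with_compose_continuous_left)
        (use smooth_self_map_continuous_on[OF diffeo_inv_smooth[OF f]] diffeo_inv_mem[OF f] in auto)
    then have "homotopic_with_canon (\<lambda>_. True) circle X c (\<lambda>_. inv_into X f a)"
      by (rule homotopic_with_eq) (use f c_mem in auto)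
    with nontrivial show False
      by blast
  qed
  then show ?thesis
    unfolding nontrivial_loop_def c(2)
    by (intro exI[of _ "f \<circ> c"]) (auto simp: image_comp embedded_circle_image[OF f c(1)])
qed

lemma nontrivial_loop_subset: "nontrivial_loop A C \<Longrightarrow> C \<subseteq> X"
  unfolding nontrivial_loop_def using loop_subset by blast

lemma geometric_bfk_image:
  assumes f: "f \<in> diffeos A" and D: "geometric_bfk A D"
  shows "geometric_bfk A (image f ` D)"
proof -
  have sub: "C \<subseteq> X" if "C \<in> D" for C
    using that D nontrivial_loop_subset unfolding geometric_bfk_def by blast
  have "disjnt (f ` C) (f ` C')" if "C \<in> D" "C' \<in> D" "f ` C \<noteq> f ` C'" for C C'
  proof -
    have "disjnt C C'"
      using D that unfolding geometric_bfk_def pairwise_def by metis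
    then show ?thesis
      using inj_on_image_Int[OF diffeo_inj_on[OF f] sub[OF that(1)] sub[OF that(2)]]
      by (auto simp: disjnt_def)
  qed
  then have "pairwise disjnt (image f ` D)"
    unfolding pairwise_def by blast
  with D show ?thesis
    unfolding geometric_bfk_def using nontrivial_loop_image[OF f] by simp
qed

lemma diagram_isotopyI:
  fixes F :: "nat \<Rightarrow> real \<Rightarrow> complex \<Rightarrow> 'a"
  assumes "\<And>i. i < n \<Longrightarrow> smooth_into A ({0..1} \<times> circle) (\<lambda>(t, z). F i t z)"
    and "\<And>t i. t \<in> {0..1} \<Longrightarrow> i < n \<Longrightarrow> embedded_circle A (F i t)"
    and "\<And>t. t \<in> {0..1} \<Longrightarrow> disjoint_family_on (\<lambda>i. F i t ` circle) {..<n}"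
    and "D = (\<lambda>i. F i 0 ` circle) ` {..<n}" "D' = (\<lambda>i. F i 1 ` circle) ` {..<n}"
  shows "diagram_isotopy A D D'"
  unfolding diagram_isotopy_def
  by (intro exI[of _ n] exI[of _ F] conjI ballI allI impI) (use assms in blast)+

lemma diagram_isotopyE:
  assumes "diagram_isotopy A D D'"
  obtains n and F :: "nat \<Rightarrow> real \<Rightarrow> complex \<Rightarrow> 'a" where "\<And>i. i < n \<Longrightarrow> smooth_into A ({0..1} \<times> circle) (\<lambda>(t, z). F i t z)"
    "\<And>t i. t \<in> {0..1} \<Longrightarrow> i < n \<Longrightarrow> embedded_circle A (F i t)"
    "\<And>t. t \<in> {0..1} \<Longrightarrow> disjoint_family_on (\<lambda>i. F i t ` circle) {..<n}"
    "D = (\<lambda>i. F i 0 ` circle) ` {..<n}" "D' = (\<lambda>i. F i 1 ` circle) ` {..<n}"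
proof -
  obtain n and F :: "nat \<Rightarrow> real \<Rightarrow> complex \<Rightarrow> 'a"
    where "(\<forall>i<n. smooth_into A ({0..1} \<times> circle) (\<lambda>(t, z). F i t z)) \<and>
     (\<forall>t\<in>{0..1}. (\<forall>i<n. embedded_circle A (F i t)) \<and>
        disjoint_family_on (\<lambda>i. F i t ` circle) {..<n}) \<and>
     D = (\<lambda>i. F i 0 ` circle) ` {..<n} \<and> D' = (\<lambda>i. F i 1 ` circle) ` {..<n}"
    using assms unfolding diagram_isotopy_def by (elim exE)
  then show ?thesis
    by (intro that[of n F]) auto
qed

lemma disjoint_family_on_image:
  assumes f: "f \<in> diffeos A" and "disjoint_family_on B I" "\<And>i. i \<in> I \<Longrightarrow> B i \<subseteq> X"
  shows "disjoint_family_on (\<lambda>i. f ` B i) I"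
proof (unfold disjoint_family_on_def, intro ballI impI)
  fix i j assume "i \<in> I" "j \<in> I" "i \<noteq> j"
  then have "f ` B i \<inter> f ` B j = f ` (B i \<inter> B j)"
    using inj_on_image_Int[OF diffeo_inj_on[OF f] assms(3) assms(3)] by simp
  also have "B i \<inter> B j = {}"
    using assms(2) \<open>i \<in> I\<close> \<open>j \<in> I\<close> \<open>i \<noteq> j\<close> by (simp add: disjoint_family_on_def)
  finally show "f ` B i \<inter> f ` B j = {}"
    by simp
qed

lemma diagram_isotopy_image:
  assumes f: "f \<in> diffeos A" and "diagram_isotopy A D D'"
  shows "diagram_isotopy A (image f ` D) (image f ` D')"
proof -
  obtain n and F :: "nat \<Rightarrow> real \<Rightarrow> complex \<Rightarrow> 'a"
    where F: "\<And>i. i < n \<Longrightarrow> smooth_into A ({0..1} \<times> circle) (\<lambda>(t, z). F i t z)"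
    "\<And>t i. t \<in> {0..1} \<Longrightarrow> i < n \<Longrightarrow> embedded_circle A (F i t)"
    "\<And>t. t \<in> {0..1} \<Longrightarrow> disjoint_family_on (\<lambda>i. F i t ` circle) {..<n}"
    "D = (\<lambda>i. F i 0 ` circle) ` {..<n}" "D' = (\<lambda>i. F i 1 ` circle) ` {..<n}"
    by (rule diagram_isotopyE[OF assms(2)]) blast
  show ?thesis
  proof (rule diagram_isotopyI[where F = "\<lambda>i t. f \<circ> F i t"])
    show "smooth_into A ({0..1} \<times> circle) (\<lambda>(t, z). (f \<circ> F i t) z)" if "i < n" for i
      using smooth_into_self_map[OF diffeo_smooth[OF f] F(1)[OF that]]
      by (simp add: o_def case_prod_unfold)
    show "embedded_circle A (f \<circ> F i t)" if "t \<in> {0..1}" "i < n" for i t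
      using embedded_circle_image[OF f F(2)[OF that]] .
    show "disjoint_family_on (\<lambda>i. (f \<circ> F i t) ` circle) {..<n}" if "t \<in> {0..1}" for t
      unfolding image_comp[symmetric]
      by (rule disjoint_family_on_image[OF f F(3)[OF that]]) (use loop_subset[OF F(2)[OF that]] in simp)
  qed (simp_all add: F(4,5) image_comp o_def)
qed

lemma diagram_isotopy_sym:
  assumes "diagram_isotopy A D D'"
  shows "diagram_isotopy A D' D"
proof -
  obtain n and F :: "nat \<Rightarrow> real \<Rightarrow> complex \<Rightarrow> 'a"
    where F: "\<And>i. i < n \<Longrightarrow> smooth_into A ({0..1} \<times> circle) (\<lambda>(t, z). F i t z)"
    "\<And>t i. t \<in> {0..1} \<Longrightarrow> i < n \<Longrightarrow> embedded_circle A (F i t)"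
    "\<And>t. t \<in> {0..1} \<Longrightarrow> disjoint_family_on (\<lambda>i. F i t ` circle) {..<n}"
    "D = (\<lambda>i. F i 0 ` circle) ` {..<n}" "D' = (\<lambda>i. F i 1 ` circle) ` {..<n}"
    by (rule diagram_isotopyE[OF assms]) blast
  have rev: "1 - t \<in> {0..1}" if "t \<in> {0..1}" for t :: real
    using that by auto
  have smooth: "smooth_on ({0..1} \<times> circle) (\<lambda>p::real \<times> complex. ((\<lambda>(t, z). 1 - t) p, snd p))"
    by (intro smooth_on_Pair smooth_on_reflect smooth_on_bounded_linear bounded_linear_snd)
  show ?thesis
  proof (rule diagram_isotopyI[where F = "\<lambda>i t. F i (1 - t)"])
    show "smooth_into A ({0..1} \<times> circle) (\<lambda>(t, z). F i (1 - t) z)" if "i < n" for i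
      by (rule smooth_into_cong[OF smooth_into_compose[OF smooth F(1)[OF that]]]) auto
  qed (use F rev in auto)
qed

text \<open>The loops of \<open>D\<close> are parametrized and enumerated once, and the isotopy moves all of them
  simultaneously; they stay disjoint because each \<open>F t\<close> is injective. For the constant isotopy at the
  identity this is reflexivity of the isotopy relation on diagrams.\<close>

lemma diagram_isotopy_family:
  assumes D: "geometric_bfk A D"
    and F: "smooth_family A F" "\<And>t. t \<in> {0..1} \<Longrightarrow> F t \<in> diffeos A"
  shows "diagram_isotopy A (image (F 0) ` D) (image (F 1) ` D)"
proof -
  obtain h and n :: nat where h: "bij_betw h {..<n} D"
    using D ex_bij_betw_nat_finite[of D] unfolding geometric_bfk_def atLeast0LessThan by blast
  have "\<exists>c. embedded_circle A c \<and> h i = c ` circle" if "i < n" for i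
    using D bij_betwE[OF h] that unfolding geometric_bfk_def nontrivial_loop_def by fast
  then obtain c where c: "\<And>i. i < n \<Longrightarrow> embedded_circle A (c i)"
      "\<And>i. i < n \<Longrightarrow> h i = c i ` circle"
    by metis
  have D_eq: "D = (\<lambda>i. c i ` circle) ` {..<n}"
    using bij_betw_imp_surj_on[OF h] c(2) by auto
  have disjoint: "disjoint_family_on (\<lambda>i. c i ` circle) {..<n}"
  proof -
    have "disjnt (h i) (h j)" if "i < n" "j < n" "i \<noteq> j" for i j
    proof -
      have "h i \<noteq> h j" "h i \<in> D" "h j \<in> D"
        using that bij_betw_imp_inj_on[OF h] bij_betwE[OF h] by (auto simp: inj_on_eq_iff)
      then show ?thesis
        using D unfolding geometric_bfk_def pairwise_def by metis
    qed
    then show ?thesis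
      using c(2) by (auto simp: disjoint_family_on_def disjnt_def)
  qed
  show ?thesis
  proof (rule diagram_isotopyI[where F = "\<lambda>i t. F t \<circ> c i" and n = n])
    show "smooth_into A ({0..1} \<times> circle) (\<lambda>(t, z). (F t \<circ> c i) z)" if "i < n" for i
    proof -
      have "smooth_into A ({0..1} \<times> circle) (\<lambda>p. F (fst p) ((\<lambda>(t, z). c i z) p))"
        by (rule smooth_into_family[OF F(1) smooth_into_snd[OF embedded_circleD(1)[OF c(1)[OF that]]]
              smooth_on_bounded_linear[OF bounded_linear_fst]]) auto
      then show ?thesis
        by (simp add: case_prod_unfold)
    qed
    show "embedded_circle A (F t \<circ> c i)" if "t \<in> {0..1}" "i < n" for i t
      using embedded_circle_image[OF F(2)[OF that(1)] c(1)[OF that(2)]] .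
    show "disjoint_family_on (\<lambda>i. (F t \<circ> c i) ` circle) {..<n}" if "t \<in> {0..1}" for t
      unfolding image_comp[symmetric]
      by (rule disjoint_family_on_image[OF F(2)[OF that] disjoint]) (use loop_subset[OF c(1)] in simp)
  qed (simp_all add: D_eq image_image)
qed

lemma geometric_bfk_image_id: "geometric_bfk A D \<Longrightarrow> image (\<lambda>x\<in>X. x) ` D = D"
proof -
  assume D: "geometric_bfk A D"
  have "(\<lambda>x\<in>X. x) ` C = C" if "C \<in> D" for C
  proof -
    have "C \<subseteq> X"
      using D that nontrivial_loop_subset unfolding geometric_bfk_def by blast
    then show ?thesis
      by (auto simp: image_iff)
  qed
  then show ?thesis
    by simp
qed

lemma bfk_relI:
  "geometric_bfk A D \<Longrightarrow> geometric_bfk A D' \<Longrightarrow> diagram_isotopy A D D' \<Longrightarrow> (D, D') \<in> bfk_rel A"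
  unfolding bfk_rel_def by (intro r_into_trancl) simp

lemma bfk_rel_geometric:
  assumes "(D, D') \<in> bfk_rel A"
  shows "geometric_bfk A D" "geometric_bfk A D'"
  using assms unfolding bfk_rel_def by (induction rule: trancl_induct) auto

lemma bfk_rel_refl: "geometric_bfk A D \<Longrightarrow> (D, D) \<in> bfk_rel A"
  using diagram_isotopy_family[OF _ smooth_family_const[OF diffeo_smooth[OF diffeo_id]] diffeo_id, of D]
  by (metis bfk_relI geometric_bfk_image_id)

lemma equiv_bfk_rel: "equiv {D. geometric_bfk A D} (bfk_rel A)"
proof (rule equivI)
  show "bfk_rel A \<subseteq> {D. geometric_bfk A D} \<times> {D. geometric_bfk A D}"
    using bfk_rel_geometric by auto
  show "refl_on {D. geometric_bfk A D} (bfk_rel A)"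
    using bfk_rel_refl by (simp add: refl_on_def)
  show "sym (bfk_rel A)"
    unfolding bfk_rel_def by (intro sym_trancl symI) (auto simp: diagram_isotopy_sym)
  show "trans (bfk_rel A)"
    unfolding bfk_rel_def by (rule trans_trancl)
qed

lemma bfk_rel_image:
  assumes f: "f \<in> diffeos A" and "(D, D') \<in> bfk_rel A"
  shows "(image f ` D, image f ` D') \<in> bfk_rel A"
  using assms(2) unfolding bfk_rel_def
proof (induction rule: trancl_induct)
  case (base D')
  then show ?case
    using diagram_isotopy_image[OF f] geometric_bfk_image[OF f] by (intro r_into_trancl) auto
next
  case (step D' D'')
  then have "(image f ` D', image f ` D'') \<in> {(D, D'). geometric_bfk A D \<and> geometric_bfk A D' \<and> diagram_isotopy A D D'}"
    using diagram_isotopy_image[OF f] geometric_bfk_image[OF f] by auto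
  with step.IH show ?case
    by (rule trancl_into_trancl)
qed

lemma bfk_rel_isotopic:
  assumes \<eta>: "\<eta> \<in> isotopic_to_id A" and D: "geometric_bfk A D"
  shows "(D, image \<eta> ` D) \<in> bfk_rel A"
proof -
  obtain F where F: "smooth_family A F" "\<And>t. t \<in> {0..1} \<Longrightarrow> F t \<in> diffeos A"
    "F 0 = \<one>\<^bsub>diffeo_group A\<^esub>" "F 1 = \<eta>"
    by (rule isotopic_to_idE[OF \<eta>]) blast
  have "diagram_isotopy A (image (F 0) ` D) (image (F 1) ` D)"
    by (rule diagram_isotopy_family[OF D F(1,2)])
  moreover have "geometric_bfk A (image \<eta> ` D)"
    using geometric_bfk_image[OF F(2)[of 1] D] F(4) by simp
  ultimately show ?thesis
    using D unfolding F(3,4) diffeo_group_one geometric_bfk_image_id[OF D] by (intro bfk_relI)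
qed

lemma mcg_elem_diffeo: "\<gamma> \<in> carrier (mcg A) \<Longrightarrow> f \<in> \<gamma> \<Longrightarrow> f \<in> diffeos A"
  using isotopy.rcosets_carrier[of \<gamma>] by (auto simp: mcg_def FactGroup_def diffeo.is_group)

lemma mcg_elemE:
  assumes "\<gamma> \<in> carrier (mcg A)"
  obtains f where "f \<in> diffeos A" "\<gamma> = isotopic_to_id A #>\<^bsub>diffeo_group A\<^esub> f"
  using assms by (auto simp: mcg_def FactGroup_def RCOSETS_def)

lemma mcg_nonempty: "\<gamma> \<in> carrier (mcg A) \<Longrightarrow> \<exists>f. f \<in> \<gamma>"
  by (erule mcg_elemE) (use diffeo.rcos_self[OF _ isotopy.subgroup_axioms] in auto)

lemma mcg_isotopic:
  assumes "\<gamma> \<in> carrier (mcg A)" "f \<in> \<gamma>" "f' \<in> \<gamma>"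
  shows "\<exists>\<eta>\<in>isotopic_to_id A. f' = \<eta> \<otimes>\<^bsub>diffeo_group A\<^esub> f"
proof -
  obtain f0 where f0: "f0 \<in> diffeos A" "\<gamma> = isotopic_to_id A #>\<^bsub>diffeo_group A\<^esub> f0"
    using mcg_elemE[OF assms(1)] .
  then have "\<gamma> = isotopic_to_id A #>\<^bsub>diffeo_group A\<^esub> f"
    using diffeo.repr_independence[of f _ f0] assms(2) isotopy.subgroup_axioms by simp
  then show ?thesis
    using assms(3) by (auto simp: r_coset_def)
qed

lemma image_compose_diagram:
  assumes "geometric_bfk A D"
  shows "image (compose X g f) ` D = image g ` image f ` D"
proof -
  have "compose X g f ` C = g ` f ` C" if "C \<in> D" for C
  proof -
    have "C \<subseteq> X"
      using assms that nontrivial_loop_subset unfolding geometric_bfk_def by blast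
    then show ?thesis
      by (auto simp: image_iff compose_eq subset_iff)
  qed
  then show ?thesis
    by (simp add: image_comp o_def)
qed

lemma bfk_class:
  assumes "E \<in> bfk A" "D \<in> E"
  shows "geometric_bfk A D" "E = bfk_rel A `` {D}"
proof -
  obtain D0 where D0: "geometric_bfk A D0" "E = bfk_rel A `` {D0}"
    using assms(1) unfolding bfk_def by (auto elim: quotientE)
  then have r: "(D0, D) \<in> bfk_rel A"
    using assms(2) by simp
  then show "geometric_bfk A D"
    using bfk_rel_geometric by blast
  show "E = bfk_rel A `` {D}"
    using equiv_class_eq[OF equiv_bfk_rel r] D0 by simp
qed

lemma bfk_classI: "geometric_bfk A D \<Longrightarrow> bfk_rel A `` {D} \<in> bfk A" "geometric_bfk A D \<Longrightarrow> D \<in> bfk_rel A `` {D}"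
  by (auto simp: bfk_def quotientI bfk_rel_refl)

text \<open>The union that defines the action is taken over all representatives, so it is a single class as soon
  as any two choices give isotopic diagrams. Passing from \<open>D\<close> to \<open>D'\<close> uses that \<open>f\<close> preserves isotopy of
  diagrams, and passing from \<open>f\<close> to \<open>f' = \<eta>f\<close> uses the isotopy from the identity to \<open>\<eta>\<close>.\<close>

lemma bfk_act_eq:
  assumes \<gamma>: "\<gamma> \<in> carrier (mcg A)" "f \<in> \<gamma>" and E: "E \<in> bfk A" "D \<in> E"
  shows "bfk_act A \<gamma> E = bfk_rel A `` {image f ` D}"
proof -
  have "bfk_rel A `` {image f' ` D'} = bfk_rel A `` {image f ` D}"
    if f'D': "f' \<in> \<gamma>" "D' \<in> E" for f' D'
  proof -
    have f: "f \<in> diffeos A"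
      using mcg_elem_diffeo[OF \<gamma>] .
    obtain \<eta> where \<eta>: "\<eta> \<in> isotopic_to_id A" "f' = \<eta> \<otimes>\<^bsub>diffeo_group A\<^esub> f"
      using mcg_isotopic[OF \<gamma> f'D'(1)] by blast
    have "\<eta> \<in> diffeos A"
      using \<eta>(1) isotopic_to_id_subset by blast
    then have f': "f' = compose X \<eta> f"
      using \<eta>(2) f by (simp add: diffeo_group_mult)
    have D': "geometric_bfk A D'" "(D, D') \<in> bfk_rel A"
      using bfk_class[OF E(1) f'D'(2)] bfk_class[OF E] f'D'(2) by auto
    have "(image f ` D, image f ` D') \<in> bfk_rel A"
      by (rule bfk_rel_image[OF f D'(2)])
    moreover have "(image f ` D', image f' ` D') \<in> bfk_rel A"
      using bfk_rel_isotopic[OF \<eta>(1) geometric_bfk_image[OF f D'(1)]]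
      by (simp only: f' image_compose_diagram[OF D'(1)])
    ultimately have "(image f ` D, image f' ` D') \<in> bfk_rel A"
      using equiv_bfk_rel by (meson equiv_def transD)
    then show ?thesis
      using equiv_class_eq[OF equiv_bfk_rel] by blast
  qed
  then have "(\<Union>f\<in>\<gamma>. \<Union>D\<in>E. bfk_rel A `` {image f ` D}) = bfk_rel A `` {image f ` D}"
    using \<gamma>(2) E(2) by blast
  then show ?thesis
    using E(1) by (simp add: bfk_act_def)
qed

lemma bfk_nonempty: "E \<in> bfk A \<Longrightarrow> \<exists>D. D \<in> E"
  unfolding bfk_def using bfk_rel_refl by (auto elim!: quotientE)

lemma bfk_act_mem:
  assumes "\<gamma> \<in> carrier (mcg A)" "E \<in> bfk A"
  shows "bfk_act A \<gamma> E \<in> bfk A"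
proof -
  obtain f D where "f \<in> \<gamma>" "D \<in> E"
    using mcg_nonempty[OF assms(1)] bfk_nonempty[OF assms(2)] by blast
  then show ?thesis
    using bfk_act_eq[OF assms(1) _ assms(2)] bfk_class(1)[OF assms(2)] assms(1)
      bfk_classI(1) geometric_bfk_image mcg_elem_diffeo by simp
qed

lemma bfk_act_mult:
  assumes \<gamma>: "\<gamma> \<in> carrier (mcg A)" "\<delta> \<in> carrier (mcg A)" and E: "E \<in> bfk A"
  shows "bfk_act A (\<gamma> \<otimes>\<^bsub>mcg A\<^esub> \<delta>) E = bfk_act A \<gamma> (bfk_act A \<delta> E)"
proof -
  obtain f g D where fgD: "f \<in> \<gamma>" "g \<in> \<delta>" "D \<in> E"
    using mcg_nonempty[OF \<gamma>(1)] mcg_nonempty[OF \<gamma>(2)] bfk_nonempty[OF E] by blast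
  have f: "f \<in> diffeos A" and g: "g \<in> diffeos A"
    using mcg_elem_diffeo \<gamma> fgD by blast+
  have D: "geometric_bfk A D"
    using bfk_class(1)[OF E fgD(3)] .
  have "compose X f g \<in> \<gamma> \<otimes>\<^bsub>mcg A\<^esub> \<delta>"
    unfolding mcg_def FactGroup_def set_mult_def
    using fgD diffeo_group_mult[OF f g, symmetric] by auto
  then have "bfk_act A (\<gamma> \<otimes>\<^bsub>mcg A\<^esub> \<delta>) E = bfk_rel A `` {image f ` image g ` D}"
    using bfk_act_eq[OF monoid.m_closed[OF group.is_monoid[OF group_mcg] \<gamma>] _ E fgD(3)]
    by (simp only: image_compose_diagram[OF D])
  also have "\<dots> = bfk_act A \<gamma> (bfk_act A \<delta> E)"
    using bfk_act_eq[OF \<gamma>(1) fgD(1) bfk_act_mem[OF \<gamma>(2) E], of "image g ` D"]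
      bfk_act_eq[OF \<gamma>(2) fgD(2) E fgD(3)] bfk_classI(2)[OF geometric_bfk_image[OF g D]] by simp
  finally show ?thesis .
qed

lemma bfk_act_one:
  assumes E: "E \<in> bfk A"
  shows "bfk_act A \<one>\<^bsub>mcg A\<^esub> E = E"
proof -
  obtain D where D: "D \<in> E"
    using bfk_nonempty[OF E] by blast
  have "(\<lambda>x\<in>X. x) \<in> \<one>\<^bsub>mcg A\<^esub>"
    using isotopy.one_closed by (simp add: mcg_def FactGroup_def diffeo_group_one)
  then show ?thesis
    using bfk_act_eq[OF monoid.one_closed[OF group.is_monoid[OF group_mcg]] _ E D]
      bfk_class[OF E D] geometric_bfk_image_id by simp
qed

end

section \<open>Cocycles of a group action\<close>

lemma group_actionI:
  assumes "group G"
    and ext: "\<And>g. g \<in> carrier G \<Longrightarrow> \<phi> g \<in> extensional E"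
    and mem: "\<And>g x. g \<in> carrier G \<Longrightarrow> x \<in> E \<Longrightarrow> \<phi> g x \<in> E"
    and one: "\<And>x. x \<in> E \<Longrightarrow> \<phi> \<one>\<^bsub>G\<^esub> x = x"
    and mult: "\<And>g h x. g \<in> carrier G \<Longrightarrow> h \<in> carrier G \<Longrightarrow> x \<in> E \<Longrightarrow> \<phi> (g \<otimes>\<^bsub>G\<^esub> h) x = \<phi> g (\<phi> h x)"
  shows "group_action G E \<phi>"
proof -
  interpret group G
    by (rule assms(1))
  have Bij: "\<phi> g \<in> Bij E" if g: "g \<in> carrier G" for g
  proof -
    have "\<phi> (inv\<^bsub>G\<^esub> g) (\<phi> g x) = x" "\<phi> g (\<phi> (inv\<^bsub>G\<^esub> g) x) = x" if "x \<in> E" for x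
      using that g mult[of "inv\<^bsub>G\<^esub> g" g x] mult[of g "inv\<^bsub>G\<^esub> g" x] one by auto
    then have "bij_betw (\<phi> g) E E"
      using g mem by (intro bij_betw_byWitness[where f' = "\<phi> (inv\<^bsub>G\<^esub> g)"]) auto
    with ext[OF g] show ?thesis
      by (simp add: Bij_def)
  qed
  have "\<phi> (g \<otimes>\<^bsub>G\<^esub> h) = compose E (\<phi> g) (\<phi> h)" if "g \<in> carrier G" "h \<in> carrier G" for g h
    by (rule extensionalityI[OF ext compose_extensional]) (use that mult in \<open>auto simp: compose_eq\<close>)
  then have "\<phi> \<in> hom G (BijGroup E)"
    using Bij by (auto simp: hom_def BijGroup_def)
  then show ?thesis
    by (simp add: group_action_def group_hom_def group_hom_axioms_def group_BijGroup assms(1))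
qed

text \<open>The primitive \<open>f\<close> is normalised to vanish on \<open>S\<close>, which forces \<open>f(w) = u(g, w)\<close> for every \<open>g\<close> with
  \<open>g\<inverse>w \<in> S\<close>. Uniqueness of the representative in the orbit of \<open>w\<close> makes any two such \<open>g\<close> differ by an
  element of the stabilizer of that representative, where \<open>u\<close> vanishes. If \<open>g\<close> is such an element for \<open>h\<inverse>w\<close>, then \<open>hg\<close> is one for \<open>w\<close>, and
  \<open>u(hg, w) = u(h, w) + u(g, h\<inverse>w)\<close> is the coboundary equation.\<close>

lemma (in group_action) cocycle_coboundary_iff:
  fixes u :: "'a \<Rightarrow> 'c \<Rightarrow> complex"
  assumes S: "S \<subseteq> E" "\<forall>Q\<in>orbits G E \<phi>. \<exists>!D. D \<in> S \<and> D \<in> Q"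
    and u: "\<And>g h w. g \<in> carrier G \<Longrightarrow> h \<in> carrier G \<Longrightarrow> w \<in> E \<Longrightarrow> u (g \<otimes> h) w = u g w + u h (\<phi> (inv g) w)"
  shows "(\<exists>f\<in>E \<rightarrow>\<^sub>E UNIV. \<forall>g\<in>carrier G. \<forall>w\<in>E. u g w = f w - f (\<phi> (inv g) w)) \<longleftrightarrow>
    (\<forall>D\<in>S. \<forall>g\<in>stabilizer G \<phi> D. u g D = 0)" (is "?L \<longleftrightarrow> ?R")
proof
  interpret group G
    using group_hom group_hom.axioms(1) by blast
  {
    assume ?L
    then obtain f where f: "\<And>g w. g \<in> carrier G \<Longrightarrow> w \<in> E \<Longrightarrow> u g w = f w - f (\<phi> (inv g) w)"
      by blast
    show ?R
    proof (intro ballI)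
      fix D g assume "D \<in> S" "g \<in> stabilizer G \<phi> D"
      then have D: "D \<in> E" "g \<in> carrier G" "\<phi> g D = D"
        using S(1) by (auto simp: stabilizer_def)
      then show "u g D = 0"
        using f[OF D(2,1)] orbit_sym_aux[OF D(2,1,3)] by simp
    qed
  next
    assume R: ?R
    have ex: "\<exists>g\<in>carrier G. \<phi> (inv g) w \<in> S" if "w \<in> E" for w
    proof -
      have "orbit G \<phi> w \<in> orbits G E \<phi>"
        using that by (auto simp: orbits_def)
      then obtain D where "D \<in> S" "D \<in> orbit G \<phi> w"
        using S(2) by blast
      then obtain g where "g \<in> carrier G" "\<phi> g w \<in> S"
        by (auto simp: orbit_def)
      then show ?thesis
        by (intro bexI[of _ "inv g"]) auto
    qed
    have indep: "u g w = u g' w"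
      if w: "w \<in> E" and g: "g \<in> carrier G" "\<phi> (inv g) w \<in> S" and g': "g' \<in> carrier G" "\<phi> (inv g') w \<in> S"
      for w g g'
    proof -
      have "\<phi> (inv g) w \<in> orbit G \<phi> w" "\<phi> (inv g') w \<in> orbit G \<phi> w"
        using g g' by (auto simp: orbit_def)
      moreover have "orbit G \<phi> w \<in> orbits G E \<phi>"
        using w by (auto simp: orbits_def)
      ultimately have D: "\<phi> (inv g') w = \<phi> (inv g) w"
        using S(2) g(2) g'(2) by blast
      \<comment> \<open>As \<open>g'\<close> moves the common representative to \<open>w\<close> and \<open>g\<inverse>\<close> moves it back, \<open>?s\<close> fixes it.\<close>
      let ?s = "inv g \<otimes> g'"
      have s: "?s \<in> carrier G"
        using g g' by simp
      have "\<phi> ?s (\<phi> (inv g') w) = \<phi> (?s \<otimes> inv g') w"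
        using composition_rule[OF w s, of "inv g'"] g' by simp
      also have "?s \<otimes> inv g' = inv g"
        using g g' by (simp add: m_assoc)
      finally have "?s \<in> stabilizer G \<phi> (\<phi> (inv g) w)"
        using s D by (simp add: stabilizer_def)
      then have "u ?s (\<phi> (inv g) w) = 0"
        using R g(2) by blast
      moreover have "g \<otimes> ?s = g'"
        using g(1) g'(1) by (simp add: m_assoc[symmetric])
      ultimately show ?thesis
        using u[OF g(1) s w] by simp
    qed
    define \<gamma> where "\<gamma> = (\<lambda>w. SOME g. g \<in> carrier G \<and> \<phi> (inv g) w \<in> S)"
    have \<gamma>: "\<gamma> w \<in> carrier G" "\<phi> (inv (\<gamma> w)) w \<in> S" if "w \<in> E" for w
      using someI_ex[of "\<lambda>g. g \<in> carrier G \<and> \<phi> (inv g) w \<in> S"] ex[OF that] unfolding \<gamma>_def by blast+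
    have "u h w = u (\<gamma> w) w - u (\<gamma> (\<phi> (inv h) w)) (\<phi> (inv h) w)"
      if h: "h \<in> carrier G" and w: "w \<in> E" for h w
    proof -
      define w' where "w' = \<phi> (inv h) w"
      have w': "w' \<in> E"
        using element_image[OF inv_closed[OF h] w] by (simp add: w'_def)
      have "\<phi> (inv (h \<otimes> \<gamma> w')) w = \<phi> (inv (\<gamma> w')) w'"
        unfolding w'_def[symmetric] using composition_rule[OF w, of "inv (\<gamma> w')" "inv h"] h \<gamma>(1)[OF w']
        by (simp add: inv_mult_group w'_def)
      then have "u (\<gamma> w) w = u (h \<otimes> \<gamma> w') w"
        by (intro indep[OF w \<gamma>[OF w]]) (use \<gamma>[OF w'] h in simp_all)
      also have "\<dots> = u h w + u (\<gamma> w') w'"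
        using u[OF h \<gamma>(1)[OF w'] w] by (simp add: w'_def)
      finally show ?thesis
        by (simp add: w'_def)
    qed
    moreover have "\<phi> (inv h) w \<in> E" if "h \<in> carrier G" "w \<in> E" for h w
      using element_image[OF inv_closed[OF that(1)] that(2)] by simp
    ultimately show ?L
      by (intro bexI[of _ "\<lambda>w\<in>E. u (\<gamma> w) w"]) auto
  }
qed

section \<open>Linear functionals on finitely supported functions\<close>

lemma bfk_span_basis_vec: "E \<in> bfk A \<Longrightarrow> basis_vec E \<in> bfk_span A"
  by (auto simp: bfk_span_def basis_vec_def)

lemma bfk_span_add:
  assumes "x \<in> bfk_span A" "y \<in> bfk_span A"
  shows "(\<lambda>E. x E + y E) \<in> bfk_span A"
proof -
  have "{E. x E + y E \<noteq> 0} \<subseteq> {E. x E \<noteq> 0} \<union> {E. y E \<noteq> 0}"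
    by auto
  from this finite_subset[OF this] show ?thesis
    using assms unfolding bfk_span_def by blast
qed

lemma bfk_span_scale:
  assumes "x \<in> bfk_span A"
  shows "(\<lambda>E. c * x E) \<in> bfk_span A"
proof -
  have "{E. c * x E \<noteq> 0} \<subseteq> {E. x E \<noteq> 0}"
    by auto
  from this finite_subset[OF this] show ?thesis
    using assms unfolding bfk_span_def by blast
qed

definition linear_ext :: "('d \<Rightarrow> complex) \<Rightarrow> ('d \<Rightarrow> complex) \<Rightarrow> complex" where
  "linear_ext f x = (\<Sum>E | x E \<noteq> 0. x E * f E)"

lemma linear_ext_superset:
  assumes "finite K" "{E. x E \<noteq> 0} \<subseteq> K"
  shows "linear_ext f x = (\<Sum>E\<in>K. x E * f E)"
  unfolding linear_ext_def by (rule sum.mono_neutral_left) (use assms in auto)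

lemma linear_ext_basis_vec: "linear_ext f (basis_vec E) = f E"
  by (subst linear_ext_superset[of "{E}"]) (auto simp: basis_vec_def)

lemma linear_ext_add:
  assumes "x \<in> bfk_span A" "y \<in> bfk_span A"
  shows "linear_ext f (\<lambda>E. x E + y E) = linear_ext f x + linear_ext f y"
proof -
  let ?K = "{E. x E \<noteq> 0} \<union> {E. y E \<noteq> 0}"
  have K: "finite ?K"
    using assms by (simp add: bfk_span_def)
  have "{E. x E + y E \<noteq> 0} \<subseteq> ?K"
    by auto
  then show ?thesis
    by (simp add: linear_ext_superset[OF K] sum.distrib algebra_simps)
qed

lemma linear_ext_scale:
  assumes "x \<in> bfk_span A"
  shows "linear_ext f (\<lambda>E. c * x E) = c * linear_ext f x"
proof -
  have "finite {E. x E \<noteq> 0}" "{E. c * x E \<noteq> 0} \<subseteq> {E. x E \<noteq> 0}"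
    using assms by (auto simp: bfk_span_def)
  then have "linear_ext f (\<lambda>E. c * x E) = (\<Sum>E | x E \<noteq> 0. c * x E * f E)"
    by (rule linear_ext_superset)
  then show ?thesis
    by (simp add: linear_ext_def sum_distrib_left mult.assoc)
qed

text \<open>The functional \<open>T\<close> is only known to be linear on \<^term>\<open>bfk_span A\<close>, so the induction is over a finite
  set of diagrams containing the support and splits off one basis vector at a time.\<close>

lemma linear_functional_eq_linear_ext:
  assumes add: "\<And>x y. x \<in> bfk_span A \<Longrightarrow> y \<in> bfk_span A \<Longrightarrow> T (\<lambda>E. x E + y E) = T x + T y"
    and scale: "\<And>c x. x \<in> bfk_span A \<Longrightarrow> T (\<lambda>E. c * x E) = c * T x"
    and x: "x \<in> bfk_span A"
  shows "T x = linear_ext (\<lambda>E. T (basis_vec E)) x"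
proof -
  have "T x = (\<Sum>E\<in>K. x E * T (basis_vec E))"
    if "finite K" "K \<subseteq> bfk A" "{E. x E \<noteq> 0} \<subseteq> K" for K x
    using that
  proof (induction K arbitrary: x)
    case empty
    then have "x = (\<lambda>E. 0 * x E)"
      by auto
    moreover have "x \<in> bfk_span A"
      using empty by (simp add: bfk_span_def)
    ultimately have "T x = 0 * T x"
      using scale[of x 0] by simp
    then show ?case
      by simp
  next
    case (insert F K)
    let ?y = "x(F := 0)" and ?z = "\<lambda>E. x F * basis_vec F E"
    have supp: "{E. ?y E \<noteq> 0} \<subseteq> K"
      using insert.prems by auto
    have y: "?y \<in> bfk_span A"
      using finite_subset[OF supp insert.hyps(1)] supp insert.prems unfolding bfk_span_def by blast
    have F: "basis_vec F \<in> bfk_span A"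
      using insert.prems by (simp add: bfk_span_basis_vec)
    have "x = (\<lambda>E. ?y E + ?z E)"
      by (auto simp: basis_vec_def)
    then have "T x = T ?y + x F * T (basis_vec F)"
      using add[OF y bfk_span_scale[OF F]] scale[OF F] by metis
    also have "T ?y = (\<Sum>E\<in>K. ?y E * T (basis_vec E))"
      using insert.prems supp by (intro insert.IH) auto
    also have "\<dots> = (\<Sum>E\<in>K. x E * T (basis_vec E))"
      using insert.hyps by (intro sum.cong) auto
    finally show ?case
      using insert.hyps by simp
  qed
  from this[of "{E. x E \<noteq> 0}" x] x show ?thesis
    by (simp add: bfk_span_def linear_ext_def)
qed

section \<open>Cocycles on diagrams and on algebraic functions\<close>

context oriented_surface
begin

lemma group_action_bfk: "group_action (mcg A) (bfk A) (bfk_act A)"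
  by (rule group_actionI[OF group_mcg])
    (auto simp: bfk_act_mem bfk_act_one bfk_act_mult, simp add: bfk_act_def)

lemma span_act_basis_vec:
  assumes \<gamma>: "\<gamma> \<in> carrier (mcg A)" and E: "E \<in> bfk A"
  shows "span_act A \<gamma> (basis_vec E) = basis_vec (bfk_act A \<gamma> E)"
proof -
  interpret group_action "mcg A" "bfk A" "bfk_act A"
    by (rule group_action_bfk)
  interpret group "mcg A"
    by (rule group_mcg)
  have "bfk_act A (inv\<^bsub>mcg A\<^esub> \<gamma>) E' = E \<longleftrightarrow> E' = bfk_act A \<gamma> E" if E': "E' \<in> bfk A" for E'
    using orbit_sym_aux[OF \<gamma> E] orbit_sym_aux[OF inv_closed[OF \<gamma>] E'] \<gamma> by auto
  then show ?thesis
    using bfk_act_mem[OF \<gamma> E] by (auto simp: span_act_def basis_vec_def fun_eq_iff)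
qed

lemma span_act_mem:
  assumes \<gamma>: "\<gamma> \<in> carrier (mcg A)" and x: "x \<in> bfk_span A"
  shows "span_act A \<gamma> x \<in> bfk_span A"
proof -
  interpret group_action "mcg A" "bfk A" "bfk_act A"
    by (rule group_action_bfk)
  interpret group "mcg A"
    by (rule group_mcg)
  have "{E. span_act A \<gamma> x E \<noteq> 0} \<subseteq> bfk_act A \<gamma> ` {E. x E \<noteq> 0}"
  proof
    fix E assume "E \<in> {E. span_act A \<gamma> x E \<noteq> 0}"
    then have E: "E \<in> bfk A" "x (bfk_act A (inv\<^bsub>mcg A\<^esub> \<gamma>) E) \<noteq> 0"
      by (auto simp: span_act_def split: if_splits)
    moreover have "bfk_act A \<gamma> (bfk_act A (inv\<^bsub>mcg A\<^esub> \<gamma>) E) = E"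
      using orbit_sym_aux[OF inv_closed[OF \<gamma>] E(1) refl] \<gamma> by simp
    ultimately show "E \<in> bfk_act A \<gamma> ` {E. x E \<noteq> 0}"
      by (metis (mono_tags) imageI mem_Collect_eq)
  qed
  then have "finite {E. span_act A \<gamma> x E \<noteq> 0}"
    by (rule finite_subset) (use x in \<open>simp add: bfk_span_def\<close>)
  then show ?thesis
    by (auto simp: bfk_span_def span_act_def)
qed

lemma span_act_add: "span_act A \<gamma> (\<lambda>E. x E + y E) = (\<lambda>E. span_act A \<gamma> x E + span_act A \<gamma> y E)"
  by (auto simp: span_act_def)

lemma span_act_scale: "span_act A \<gamma> (\<lambda>E. c * x E) = (\<lambda>E. c * span_act A \<gamma> x E)"
  by (auto simp: span_act_def)

lemma bfk_coboundary_iff: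
  assumes S: "orbit_representatives A S"
    and u: "u \<in> cocycles (mcg A) (bfk A) (bfk_act A) (bfk_hat A)"
  shows "is_coboundary (mcg A) (bfk A) (bfk_act A) (bfk_hat A) u \<longleftrightarrow>
    (\<forall>D\<in>S. \<forall>\<gamma>\<in>stabilizer (mcg A) (bfk_act A) D. u \<gamma> D = 0)"
  unfolding is_coboundary_def bfk_hat_def
  by (rule group_action.cocycle_coboundary_iff[OF group_action_bfk])
    (use S u in \<open>auto simp: orbit_representatives_def cocycles_def\<close>)

lemma
  assumes "holonomy_iso A p as \<nu>"
  shows holonomy_iso_bij: "bij_betw \<nu> (bfk_span A) (alg_funs A p as)"
    and holonomy_iso_add: "x \<in> bfk_span A \<Longrightarrow> y \<in> bfk_span A \<Longrightarrow>
      \<nu> (\<lambda>E. x E + y E) = (\<lambda>m\<in>moduli A p. \<nu> x m + \<nu> y m)"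
    and holonomy_iso_scale: "x \<in> bfk_span A \<Longrightarrow> \<nu> (\<lambda>E. c * x E) = (\<lambda>m\<in>moduli A p. c * \<nu> x m)"
    and holonomy_iso_act: "\<gamma> \<in> carrier (mcg A) \<Longrightarrow> x \<in> bfk_span A \<Longrightarrow>
      \<nu> (span_act A \<gamma> x) = alg_act A p \<gamma> (\<nu> x)"
  using assms unfolding holonomy_iso_def by simp_all

lemma alg_dual_linear_ext:
  assumes \<nu>: "holonomy_iso A p as \<nu>" and \<xi>: "\<xi> \<in> alg_dual A p as" and x: "x \<in> bfk_span A"
  shows "\<xi> (\<nu> x) = linear_ext (\<lambda>E. \<xi> (\<nu> (basis_vec E))) x"
proof (rule linear_functional_eq_linear_ext[OF _ _ x])
  have mem: "\<nu> x \<in> alg_funs A p as" if "x \<in> bfk_span A" for x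
    using bij_betw_apply[OF holonomy_iso_bij[OF \<nu>] that] .
  show "\<xi> (\<nu> (\<lambda>E. x E + y E)) = \<xi> (\<nu> x) + \<xi> (\<nu> y)" if "x \<in> bfk_span A" "y \<in> bfk_span A" for x y
    using \<xi> mem that unfolding holonomy_iso_add[OF \<nu> that] alg_dual_def by blast
  show "\<xi> (\<nu> (\<lambda>E. c * x E)) = c * \<xi> (\<nu> x)" if "x \<in> bfk_span A" for c x
    using \<xi> mem that unfolding holonomy_iso_scale[OF \<nu> that] alg_dual_def by blast
qed

lemma linear_ext_alg_dual:
  assumes \<nu>: "holonomy_iso A p as \<nu>"
  obtains \<xi> where "\<xi> \<in> alg_dual A p as" "\<And>x. x \<in> bfk_span A \<Longrightarrow> \<xi> (\<nu> x) = linear_ext f x"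
proof -
  define \<xi> where "\<xi> = (\<lambda>y\<in>alg_funs A p as. linear_ext f (inv_into (bfk_span A) \<nu> y))"
  note bij = holonomy_iso_bij[OF \<nu>]
  have \<xi>: "\<xi> (\<nu> x) = linear_ext f x" if "x \<in> bfk_span A" for x
    using bij_betw_apply[OF bij that] bij_betw_inv_into_left[OF bij that] by (simp add: \<xi>_def)
  have "\<xi> \<in> alg_dual A p as"
    unfolding alg_dual_def
  proof (intro CollectI conjI allI ballI IntI)
    show "\<xi> \<in> extensional (alg_funs A p as)"
      by (simp add: \<xi>_def)
    fix y assume "y \<in> alg_funs A p as"
    then obtain x where x: "x \<in> bfk_span A" "y = \<nu> x"
      using bij_betw_imp_surj_on[OF bij] by blast
    show "\<xi> (\<lambda>m\<in>moduli A p. c * y m) = c * \<xi> y" for c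
      unfolding x(2) holonomy_iso_scale[OF \<nu> x(1), symmetric]
      by (simp add: \<xi> x(1) bfk_span_scale linear_ext_scale[OF x(1)])
    fix y' assume "y' \<in> alg_funs A p as"
    then obtain x' where x': "x' \<in> bfk_span A" "y' = \<nu> x'"
      using bij_betw_imp_surj_on[OF bij] by blast
    show "\<xi> (\<lambda>m\<in>moduli A p. y m + y' m) = \<xi> y + \<xi> y'"
      unfolding x(2) x'(2) holonomy_iso_add[OF \<nu> x(1) x'(1), symmetric]
      by (simp add: \<xi> x(1) x'(1) bfk_span_add linear_ext_add[OF x(1) x'(1)])
  qed
  with \<xi> show ?thesis
    using that by blast
qed

text \<open>Evaluating \<open>u\<close> on the basis \<open>\<nu>(D)\<close> gives a cocycle \<open>v\<close> on diagrams. A primitive of \<open>u\<close> restricts to one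
  of \<open>v\<close>. Conversely, a primitive \<open>f\<close> of \<open>v\<close> extends linearly to a functional \<open>\<xi>\<close> on the algebraic functions;
  the equation \<open>u \<gamma> = \<xi> - \<gamma> \<cdot> \<xi>\<close> holds on the basis and hence everywhere, both sides being linear.\<close>

lemma alg_coboundary_iff:
  assumes S: "orbit_representatives A S" and \<nu>: "holonomy_iso A p as \<nu>"
    and u: "u \<in> cocycles (mcg A) (alg_funs A p as) (alg_act A p) (alg_dual A p as)"
  shows "is_coboundary (mcg A) (alg_funs A p as) (alg_act A p) (alg_dual A p as) u \<longleftrightarrow>
    (\<forall>D\<in>S. \<forall>\<gamma>\<in>stabilizer (mcg A) (bfk_act A) D. u \<gamma> (\<nu> (basis_vec D)) = 0)"
proof -
  interpret group_action "mcg A" "bfk A" "bfk_act A"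
    by (rule group_action_bfk)
  interpret group "mcg A"
    by (rule group_mcg)
  define v where "v = (\<lambda>\<gamma>. \<lambda>E\<in>bfk A. u \<gamma> (\<nu> (basis_vec E)))"
  note bij = holonomy_iso_bij[OF \<nu>]
  have mem: "\<nu> x \<in> alg_funs A p as" if "x \<in> bfk_span A" for x
    using bij_betw_apply[OF bij that] .
  have act: "alg_act A p \<gamma> (\<nu> (basis_vec E)) = \<nu> (basis_vec (bfk_act A \<gamma> E))"
    if "\<gamma> \<in> carrier (mcg A)" "E \<in> bfk A" for \<gamma> E
    using holonomy_iso_act[OF \<nu> that(1) bfk_span_basis_vec[OF that(2)]] span_act_basis_vec[OF that] by simp
  have u_dual: "u \<gamma> \<in> alg_dual A p as" if "\<gamma> \<in> carrier (mcg A)" for \<gamma>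
    using u that by (auto simp: cocycles_def)
  have v_cocycle: "v \<in> cocycles (mcg A) (bfk A) (bfk_act A) (bfk_hat A)"
    using u act bfk_act_mem mem[OF bfk_span_basis_vec] by (auto simp: cocycles_def v_def bfk_hat_def)
  have "is_coboundary (mcg A) (alg_funs A p as) (alg_act A p) (alg_dual A p as) u \<longleftrightarrow>
      is_coboundary (mcg A) (bfk A) (bfk_act A) (bfk_hat A) v"
  proof
    assume "is_coboundary (mcg A) (alg_funs A p as) (alg_act A p) (alg_dual A p as) u"
    then obtain \<xi> where \<xi>: "\<And>\<gamma> y. \<gamma> \<in> carrier (mcg A) \<Longrightarrow> y \<in> alg_funs A p as \<Longrightarrow>
        u \<gamma> y = \<xi> y - \<xi> (alg_act A p (inv\<^bsub>mcg A\<^esub> \<gamma>) y)"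
      by (auto simp: is_coboundary_def)
    show "is_coboundary (mcg A) (bfk A) (bfk_act A) (bfk_hat A) v"
      unfolding is_coboundary_def bfk_hat_def
      by (rule bexI[of _ "\<lambda>E\<in>bfk A. \<xi> (\<nu> (basis_vec E))"])
        (use \<xi> act bfk_act_mem mem[OF bfk_span_basis_vec] in \<open>auto simp: v_def\<close>)
  next
    assume "is_coboundary (mcg A) (bfk A) (bfk_act A) (bfk_hat A) v"
    then obtain f where f: "\<And>\<gamma> E. \<gamma> \<in> carrier (mcg A) \<Longrightarrow> E \<in> bfk A \<Longrightarrow>
        v \<gamma> E = f E - f (bfk_act A (inv\<^bsub>mcg A\<^esub> \<gamma>) E)"
      by (auto simp: is_coboundary_def)
    obtain \<xi> where \<xi>: "\<xi> \<in> alg_dual A p as" "\<And>x. x \<in> bfk_span A \<Longrightarrow> \<xi> (\<nu> x) = linear_ext f x"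
      using linear_ext_alg_dual[OF \<nu>] by blast
    have "u \<gamma> y = \<xi> y - \<xi> (alg_act A p (inv\<^bsub>mcg A\<^esub> \<gamma>) y)"
      if \<gamma>: "\<gamma> \<in> carrier (mcg A)" and "y \<in> alg_funs A p as" for \<gamma> y
    proof -
      obtain x where x: "x \<in> bfk_span A" "y = \<nu> x"
        using \<open>y \<in> alg_funs A p as\<close> bij_betw_imp_surj_on[OF bij] by blast
      have \<gamma>': "inv\<^bsub>mcg A\<^esub> \<gamma> \<in> carrier (mcg A)"
        using \<gamma> by simp
      \<comment> \<open>Adding the translated term to \<open>u \<gamma>\<close> turns the claim into \<open>T = f\<close> on the basis.\<close>
      define T where "T = (\<lambda>x. u \<gamma> (\<nu> x) + linear_ext f (span_act A (inv\<^bsub>mcg A\<^esub> \<gamma>) x))"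
      have "T x = linear_ext (\<lambda>E. T (basis_vec E)) x"
      proof (rule linear_functional_eq_linear_ext[OF _ _ x(1)])
        note lin = alg_dual_linear_ext[OF \<nu> u_dual[OF \<gamma>]]
        show "T (\<lambda>E. x E + y E) = T x + T y" if "x \<in> bfk_span A" "y \<in> bfk_span A" for x y
          using that by (simp add: T_def lin bfk_span_add span_act_add linear_ext_add[of _ A] span_act_mem[OF \<gamma>'])
        show "T (\<lambda>E. c * x E) = c * T x" if "x \<in> bfk_span A" for c x
          using that by (simp add: T_def lin bfk_span_scale span_act_scale linear_ext_scale[of _ A]
              span_act_mem[OF \<gamma>'] algebra_simps)
      qed
      also have "\<dots> = linear_ext f x"
      proof -
        have "T (basis_vec E) = f E" if "E \<in> bfk A" for E
          using f[OF \<gamma> that] that by (simp add: T_def v_def span_act_basis_vec[OF \<gamma>'] linear_ext_basis_vec)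
        then show ?thesis
          using x(1) unfolding linear_ext_def bfk_span_def by (intro sum.cong) auto
      qed
      finally show ?thesis
        using \<xi>(2)[OF x(1)] \<xi>(2)[OF span_act_mem[OF \<gamma>' x(1)]] holonomy_iso_act[OF \<nu> \<gamma>' x(1)]
        by (simp add: T_def x(2) algebra_simps)
    qed
    with \<xi>(1) show "is_coboundary (mcg A) (alg_funs A p as) (alg_act A p) (alg_dual A p as) u"
      unfolding is_coboundary_def by blast
  qed
  also have "\<dots> \<longleftrightarrow> (\<forall>D\<in>S. \<forall>\<gamma>\<in>stabilizer (mcg A) (bfk_act A) D. v \<gamma> D = 0)"
    by (rule bfk_coboundary_iff[OF S v_cocycle])
  also have "\<dots> \<longleftrightarrow> (\<forall>D\<in>S. \<forall>\<gamma>\<in>stabilizer (mcg A) (bfk_act A) D. u \<gamma> (\<nu> (basis_vec D)) = 0)"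
    using S by (auto simp: v_def orbit_representatives_def subset_iff)
  finally show ?thesis .
qed

end

theorem theorem1p1:
  fixes A :: "'a::t2_space atlas" and g r :: nat and S :: "'a set set set set"
  assumes "surface g r A" and "orbit_representatives A S"
  shows "(\<forall>u \<in> cocycles (mcg A) (bfk A) (bfk_act A) (bfk_hat A).
            is_coboundary (mcg A) (bfk A) (bfk_act A) (bfk_hat A) u \<longleftrightarrow>
            (\<forall>D\<in>S. \<forall>\<gamma>\<in>stabilizer (mcg A) (bfk_act A) D. u \<gamma> D = 0))
    \<and> (\<forall>p\<in>pts A. \<forall>as \<nu>. generators A p as \<and> holonomy_iso A p as \<nu> \<longrightarrow>
         (\<forall>u \<in> cocycles (mcg A) (alg_funs A p as) (alg_act A p) (alg_dual A p as).
            is_coboundary (mcg A) (alg_funs A p as) (alg_act A p) (alg_dual A p as) u \<longleftrightarrow>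
            (\<forall>D\<in>S. \<forall>\<gamma>\<in>stabilizer (mcg A) (bfk_act A) D. u \<gamma> (\<nu> (basis_vec D)) = 0)))"
proof -
  interpret oriented_surface A
    by unfold_locales (use assms(1) in \<open>simp add: surface_def\<close>)
  show ?thesis
    using bfk_coboundary_iff[OF assms(2)] alg_coboundary_iff[OF assms(2)] by blast
qed

end
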